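(* Let $H$ be a locally compact second countable group with left Haar measure $m_H$ and a proper left-invariant metric $d$, and assume $(H,d)$ has sub-exponential growth, i.e. $\limsup_{r\to\infty} \frac{\log m_H(B_d(e,r))}{r}=0$, where $B_d(e,r)$ is the $d$-ball of radius $r$ about the identity $e$. Let $(F_T)$ be a right Følner sequence in $H$ with $m_H(F_T)\to\infty$. Suppose $H$ acts on a probability space $(X,\mu)$ and this action is exponentially mixing of all orders on an $H$-invariant subalgebra $\mathcal{A}$ of $L^\infty(X,\mu)$ with respect to $d$ and a family of seminorms $(N_s)$ as described in the context. Then for every $f\in\mathcal{A}$ with $\mu(f)=0$, $$\frac{1}{m_H(F_T)^{1/2}}\int_{F_T} (f\circ h^{-1})\,dm_H(h)\implies N(0,\sigma_f^2)\quad\text{as } T\to\infty,$$ where $\sigma_f^2=\int_H \langle f, f\circ h^{-1}\rangle\,dm_H(h)$, and $\implies$ denotes convergence in distribution of functions on $(X,\mu)$.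
   Context: A sequence $(F_T)$ of compact subsets of $H$ with non-empty interior is right Følner if $m_H(F_T\triangle F_Th)/m_H(F_T)\to 0$ for all $h\in H$. The action of $H$ on $(X,\mu)$ is jointly measurable and measure-preserving; $H$ acts on functions by $h\cdot f=f\circ h^{-1}$. $\mathcal{A}\subset L^\infty(X,\mu)$ is an $H$-invariant subalgebra and $(N_s)_{s\ge1}$ is a family of seminorms on $\mathcal{A}$ such that for all $s\ge1$, all $f,f_1,f_2\in\mathcal{A}$ and $h\in H$ (implied constants depending only on $s$): $N_s(f)\ll N_{s+1}(f)$; $\|f\|_{L^\infty}\ll N_s(f)$; there is $\sigma_s>0$ with $N_s(h\cdot f)\ll e^{\sigma_s d(h,e)}N_s(f)$; and $N_s(f_1f_2)\ll N_{s+1}(f_1)N_{s+1}(f_2)$. Exponential mixing of all orders means: for every integer $r\ge2$ there exist $\delta_r>0$ and an integer $s_r>0$ such that for all $s>s_r$, all $f_1,\dots,f_r\in\mathcal{A}$ and all $h_1,\dots,h_r\in H$, $$\Big|\mu\Big(\prod_{i=1}^r h_i\cdot f_i\Big)-\prod_{i=1}^r\mu(f_i)\Big|\le C_{r,s}\, e^{-\delta_r \min_{i\ne j} d(h_i,h_j)}\prod_{i=1}^r N_s(f_i),$$ with $C_{r,s}$ depending only on $r,s$. *)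

theory Defs
  imports "HOL-Probability.Probability"
begin

text \<open>The group H is written additively (class group_add, which is NOT assumed commutative):
  identity 0, product g + h, inverse - g.\<close>

definition group_action :: "('h::group_add \<Rightarrow> 'x \<Rightarrow> 'x) \<Rightarrow> bool" where
  "group_action act \<longleftrightarrow> (\<forall>x. act 0 x = x) \<and> (\<forall>g h x. act (g + h) x = act g (act h x))"

definition trans_fun :: "('h::group_add \<Rightarrow> 'x \<Rightarrow> 'x) \<Rightarrow> 'h \<Rightarrow> ('x \<Rightarrow> real) \<Rightarrow> ('x \<Rightarrow> real)" where
  "trans_fun act h f = (\<lambda>x. f (act (- h) x))"

definition left_haar :: "'h::{topological_space, group_add} measure \<Rightarrow> bool" where
  "left_haar m \<longleftrightarrow> sets m = sets borel
     \<and> (\<forall>g A. A \<in> sets borel \<longrightarrow> emeasure m ((\<lambda>x. g + x) ` A) = emeasure m A)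
     \<and> (\<forall>K. compact K \<longrightarrow> emeasure m K < \<infinity>)
     \<and> (\<forall>U. open U \<and> U \<noteq> {} \<longrightarrow> emeasure m U > 0)"

definition right_folner :: "'h::{topological_space, group_add} measure \<Rightarrow> (nat \<Rightarrow> 'h set) \<Rightarrow> bool" where
  "right_folner m F \<longleftrightarrow> (\<forall>T. compact (F T) \<and> interior (F T) \<noteq> {})
     \<and> (\<forall>h. ((\<lambda>T. measure m ((F T - (\<lambda>x. x + h) ` F T) \<union> ((\<lambda>x. x + h) ` F T - F T))
                    / measure m (F T)) \<longlongrightarrow> 0) sequentially)"

definition inv_subalgebra :: "'x measure \<Rightarrow> ('h::group_add \<Rightarrow> 'x \<Rightarrow> 'x) \<Rightarrow> ('x \<Rightarrow> real) set \<Rightarrow> bool" where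
  "inv_subalgebra M act A \<longleftrightarrow> A \<subseteq> borel_measurable M
     \<and> (\<forall>f\<in>A. \<forall>g\<in>A. (\<lambda>x. f x + g x) \<in> A \<and> (\<lambda>x. f x * g x) \<in> A)
     \<and> (\<forall>f\<in>A. \<forall>c. (\<lambda>x. c * f x) \<in> A)
     \<and> (\<forall>f\<in>A. \<forall>h. trans_fun act h f \<in> A)"

definition adm_seminorms :: "'x measure \<Rightarrow> ('h::{metric_space, group_add} \<Rightarrow> 'x \<Rightarrow> 'x)
     \<Rightarrow> ('x \<Rightarrow> real) set \<Rightarrow> (nat \<Rightarrow> ('x \<Rightarrow> real) \<Rightarrow> real) \<Rightarrow> bool" where
  "adm_seminorms M act A N \<longleftrightarrow>
     (\<forall>s\<ge>1. \<forall>f\<in>A. \<forall>g\<in>A. \<forall>c. N s f \<ge> 0 \<and> N s (\<lambda>x. f x + g x) \<le> N s f + N s g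
                              \<and> N s (\<lambda>x. c * f x) = \<bar>c\<bar> * N s f)
   \<and> (\<forall>s\<ge>1. \<exists>C. \<forall>f\<in>A. N s f \<le> C * N (s + 1) f)
   \<and> (\<forall>s\<ge>1. \<exists>C. \<forall>f\<in>A. AE x in M. \<bar>f x\<bar> \<le> C * N s f)
   \<and> (\<forall>s\<ge>1. \<exists>\<sigma>>0. \<exists>C. \<forall>f\<in>A. \<forall>h. N s (trans_fun act h f) \<le> C * exp (\<sigma> * dist h 0) * N s f)
   \<and> (\<forall>s\<ge>1. \<exists>C. \<forall>f1\<in>A. \<forall>f2\<in>A. N s (\<lambda>x. f1 x * f2 x) \<le> C * N (s + 1) f1 * N (s + 1) f2)"

definition exp_mixing_all_orders :: "'x measure \<Rightarrow> ('h::{metric_space, group_add} \<Rightarrow> 'x \<Rightarrow> 'x)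
     \<Rightarrow> ('x \<Rightarrow> real) set \<Rightarrow> (nat \<Rightarrow> ('x \<Rightarrow> real) \<Rightarrow> real) \<Rightarrow> bool" where
  "exp_mixing_all_orders M act A N \<longleftrightarrow>
     (\<forall>r::nat. r \<ge> 2 \<longrightarrow> (\<exists>\<delta>::real>0. \<exists>sr::nat>0. \<forall>s>sr. \<exists>C::real.
        \<forall>(fs :: nat \<Rightarrow> 'x \<Rightarrow> real) (hs :: nat \<Rightarrow> 'h). (\<forall>i<r. fs i \<in> A) \<longrightarrow>
          \<bar>(\<integral>x. (\<Prod>i<r. trans_fun act (hs i) (fs i) x) \<partial>M) - (\<Prod>i<r. \<integral>x. fs i x \<partial>M)\<bar>
            \<le> C * exp (- \<delta> * Min {dist (hs i) (hs j) | i j. i < r \<and> j < r \<and> i \<noteq> j})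
                * (\<Prod>i<r. N s (fs i))))"

definition normal_law :: "real \<Rightarrow> real measure" where
  "normal_law v = (if v > 0 then density lborel (normal_density 0 (sqrt v)) else return borel 0)"

end

theory Submission
  imports Defs
begin

text \<open>
  The moments of the normalized orbit integrals are shown to satisfy, in the limit, the recursion
  \<open>M\<^sub>r = (r - 1) \<sigma>\<^sup>2 M\<^bsub>r-2\<^esub>\<close> of the moments of the normal law. The moment of order r is the integral
  over tuples of elements of F of the r-point correlation. By the pigeonhole principle, among the
  geometric scales D, K D, K^2 D, ... with D of order log (m F) there is one such that no two
  points of a given tuple have distance in the band between it and the next. At this scale the
  tuple splits into clusters of diameter at most the scale that are separated by K times the
  scale. Applying exponential mixing to the products of f over the clusters, whose seminorms grow
  exponentially in the diameter, shows that for large K the correlation is the product of the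
  correlations of the clusters, up to an error that is a large negative power of m F. A one-point
  cluster makes the correlation negligible since f has mean zero. If there is none and the cluster
  of the first point is a pair, this pair splits off, which gives the main term. All other tuples
  have at most (r - 1) / 2 clusters, and by subexponential growth they fill a set of measure
  (m F)^((r - 1) / 2 + o(1)), which is negligible compared to (m F)^(r / 2).
\<close>

subsection \<open>Method of moments for the normal law\<close>

text \<open>The obstacle is that the scale at which a tuple splits, and its clusters, depend on the
  tuple, while moments are integrals over all tuples. Two devices remove this dependence. The main
  term is the sum over all j of \<open>corr {0, j} h * corr ({1..<r} - {j}) h\<close>, taken at
  every tuple and not only where 0 and j form a cluster: its unwanted terms are themselves small, or
  else the tuple is exceptional. Hence it integrates exactly, by Fubini, to r - 1 copies of a second
  moment times a moment of order r - 2, with no cutoff and no count of pairings. The exceptional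
  tuples are controlled by a sum over finitely many maps of indices at the largest scale, which is a
  measurable function that does not refer to clusters.

  The ratio K of successive scales has to serve at all scales at once. It can, because cluster
  seminorms grow like exp (\<tau> D) while mixing at separation K D decays like exp (- \<delta> K
  D), with rates that do not depend on D.

  Subexponential growth is needed a second time, to integrate the covariance over H. The variance
  then arises from the Folner property by dominated convergence. \<open>normal_moment\<close> is
  defined by the recursion itself, so that the final induction matches it term by term.\<close>

fun normal_moment :: "real \<Rightarrow> nat \<Rightarrow> real" where
  "normal_moment v 0 = 1"
| "normal_moment v (Suc 0) = 0"
| "normal_moment v (Suc (Suc k)) = real (Suc k) * v * normal_moment v k"

lemma normal_moment_odd: "normal_moment v (Suc (2 * n)) = 0"
  by (induction n) auto

text \<open>The factor (2 n)! / (n! 2^n) is the number of pairings of 2 n points.\<close>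

lemma normal_moment_even: "normal_moment v (2 * n) = fact (2 * n) / fact n * (v / 2) ^ n"
proof (induction n)
  case (Suc n)
  have "normal_moment v (2 * Suc n) = real (Suc (2 * n)) * v * (fact (2 * n) / fact n * (v / 2) ^ n)"
    using Suc by simp
  also have "\<dots> = fact (2 * Suc n) / fact (Suc n) * (v / 2) ^ Suc n"
    by (simp add: divide_simps)
  finally show ?case .
qed simp

text \<open>Odd moments vanish and the factorial (2 j)! cancels, so the formal Taylor polynomial of
  the characteristic function is a partial sum of the series of exp (- v t^2 / 2).\<close>

lemma sum_iexp_normal_moment:
  "(\<Sum>k\<le>2 * n. (\<i> * complex_of_real t) ^ k / fact k * complex_of_real (normal_moment v k))
     = of_real (\<Sum>j\<le>n. (- (v * t\<^sup>2 / 2)) ^ j /\<^sub>R fact j)"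
proof (induction n)
  case (Suc n)
  let ?a = "\<lambda>k. (\<i> * complex_of_real t) ^ k / fact k * complex_of_real (normal_moment v k)"
  have "(\<i> * complex_of_real t) ^ (2 * Suc n) = complex_of_real ((- (t\<^sup>2)) ^ Suc n)"
    by (simp only: power_mult) (simp add: power_mult_distrib[of \<i>])
  then have "?a (2 * Suc n)
      = complex_of_real ((- (t\<^sup>2)) ^ Suc n / fact (2 * Suc n) * normal_moment v (2 * Suc n))"
    by (simp only: of_real_mult of_real_divide of_real_fact)
  also have "(- (t\<^sup>2)) ^ Suc n / fact (2 * Suc n) * normal_moment v (2 * Suc n)
      = (- (v * t\<^sup>2 / 2)) ^ Suc n /\<^sub>R fact (Suc n)"
  proof -
    have "(- (t\<^sup>2)) ^ Suc n * (v / 2) ^ Suc n = (- (v * t\<^sup>2 / 2)) ^ Suc n"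
      by (simp only: power_mult_distrib[symmetric]) (simp add: field_simps)
    moreover have "a / c * (c / d * b) = (a * b) /\<^sub>R d" if "c \<noteq> 0" for a b c d :: real
      using that by (simp add: field_simps)
    ultimately show ?thesis
      unfolding normal_moment_even by (metis fact_nonzero)
  qed
  finally have even: "?a (2 * Suc n) = of_real ((- (v * t\<^sup>2 / 2)) ^ Suc n /\<^sub>R fact (Suc n))" .
  have odd: "?a (Suc (2 * n)) = 0"
    by (simp only: normal_moment_odd) simp
  have "(\<Sum>k\<le>2 * Suc n. ?a k) = (\<Sum>k\<le>2 * n. ?a k) + ?a (Suc (2 * n)) + ?a (2 * Suc n)"
    by simp
  also have "\<dots> = of_real (\<Sum>j\<le>Suc n. (- (v * t\<^sup>2 / 2)) ^ j /\<^sub>R fact j)"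
    unfolding Suc even odd by simp
  finally show ?case .
qed simp

lemma real_distribution_normal_law: "v \<ge> 0 \<Longrightarrow> real_distribution (normal_law v)"
  unfolding normal_law_def real_distribution_def real_distribution_axioms_def
  by (auto intro!: prob_space_normal_density prob_space_return)

lemma char_normal_law:
  assumes "v \<ge> 0"
  shows "char (normal_law v) t = of_real (exp (- (v * t\<^sup>2 / 2)))"
proof (cases "v > 0")
  case True
  let ?N = std_normal_distribution
  interpret N: real_distribution ?N by (rule real_dist_normal_dist)
  have "distributed ?N lborel (\<lambda>x. x) std_normal_density"
    by (auto simp: distributed_def distr_id2)
  then have "distributed ?N lborel (\<lambda>x. 0 + sqrt v * x)
      (normal_density (0 + sqrt v * 0) (\<bar>sqrt v\<bar> * 1))"
    by (rule N.normal_density_affine) (use True in auto)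
  then have "distr ?N lborel (\<lambda>x. sqrt v * x) = normal_law v"
    using True by (simp add: distributed_def normal_law_def)
  moreover have "distr ?N lborel (\<lambda>x. sqrt v * x) = distr ?N borel (\<lambda>x. sqrt v * x)"
    by (rule distr_cong) auto
  ultimately have "char (normal_law v) t = char (distr ?N borel (\<lambda>x. sqrt v * x)) t"
    by simp
  also have "\<dots> = char ?N (t * sqrt v)"
    unfolding char_def by (subst integral_distr) (auto simp: mult.assoc)
  also have "\<dots> = of_real (exp (- (v * t\<^sup>2 / 2)))"
    using True by (simp add: char_std_normal_distribution power_mult_distrib mult.commute)
  finally show ?thesis .
next
  case False
  with assms have "v = 0" by simp
  then show ?thesis
    by (simp add: normal_law_def char_def integral_return)
qed

text \<open>By Levy's theorem it is enough that characteristic functions converge pointwise. Each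
  differs from a polynomial in its moments by a Taylor remainder. The degree \<open>2 * K\<close> is
  even, so the absolute moment in the remainder is an ordinary moment with a known limit. First n
  tends to infinity with \<open>K\<close> fixed, then \<open>K\<close> grows.\<close>

lemma (in prob_space) moments_imp_weak_conv_normal:
  fixes X :: "nat \<Rightarrow> 'a \<Rightarrow> real"
  assumes meas[measurable]: "\<And>n. X n \<in> borel_measurable M"
    and int: "\<And>n k. integrable M (\<lambda>x. X n x ^ k)"
    and lim: "\<And>k. (\<lambda>n. expectation (\<lambda>x. X n x ^ k)) \<longlonglongrightarrow> normal_moment v k"
    and v: "v \<ge> 0"
  shows "weak_conv_m (\<lambda>n. distr M borel (X n)) (normal_law v)"
proof (rule levy_continuity)
  show "real_distribution (distr M borel (X n))" for n
    by (rule real_distribution_distr) simp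
  show "real_distribution (normal_law v)"
    using v by (rule real_distribution_normal_law)
  fix t
  let ?\<phi> = "\<lambda>n. char (distr M borel (X n)) t"
  define y where "y = v * t\<^sup>2 / 2"
  define P where "P K = (\<Sum>j\<le>K. (- y) ^ j /\<^sub>R fact j)" for K :: nat
  define Q where "Q K n = (\<Sum>k\<le>2 * K. (\<i> * complex_of_real t) ^ k / fact k
      * complex_of_real (expectation (\<lambda>x. X n x ^ k)))" for K n
  define R where "R K n = 2 * \<bar>t\<bar> ^ (2 * K) / fact (2 * K) * expectation (\<lambda>x. X n x ^ (2 * K))" for K n
  have approx: "cmod (?\<phi> n - Q K n) \<le> R K n" for K n
    using char_approx1'[of "2 * K" "X n" "distr M borel (X n)" t] int
    by (simp add: Q_def R_def power_even_abs)
  have Qlim: "Q K \<longlonglongrightarrow> of_real (P K)" for K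
    unfolding P_def y_def sum_iexp_normal_moment[symmetric] Q_def
    by (intro tendsto_intros lim)
  \<comment> \<open>The limit is twice a term of the exponential series of \<open>y\<close>, hence
    small for large \<open>K\<close>. Here the moderate growth of Gaussian moments enters.\<close>
  have Rlim: "R K \<longlonglongrightarrow> 2 * (y ^ K /\<^sub>R fact K)" for K
  proof -
    have "R K \<longlonglongrightarrow> 2 * \<bar>t\<bar> ^ (2 * K) / fact (2 * K) * normal_moment v (2 * K)"
      unfolding R_def by (intro tendsto_intros lim)
    also have "2 * \<bar>t\<bar> ^ (2 * K) / fact (2 * K) * normal_moment v (2 * K) = 2 * (y ^ K /\<^sub>R fact K)"
    proof -
      have cancel: "2 * a / c * (c / d * b) = 2 * ((a * b) /\<^sub>R d)" if "c \<noteq> 0" for a b c d :: real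
        using that by (simp add: field_simps)
      have "\<bar>t\<bar> ^ (2 * K) * (v / 2) ^ K = (\<bar>t\<bar>\<^sup>2 * (v / 2)) ^ K"
        by (simp only: power_mult power_mult_distrib)
      also have "\<bar>t\<bar>\<^sup>2 * (v / 2) = y"
        by (simp add: y_def mult.commute)
      finally show ?thesis
        unfolding normal_moment_even using cancel[of "fact (2 * K)"] by (metis fact_nonzero)
    qed
    finally show ?thesis .
  qed
  have Plim: "P \<longlonglongrightarrow> exp (- y)"
    unfolding P_def using exp_converges[of "- y"] by (simp add: sums_def_le)
  have tail: "(\<lambda>K. 2 * (y ^ K /\<^sub>R fact K)) \<longlonglongrightarrow> 2 * 0"
    using summable_LIMSEQ_zero[OF summable_exp_generic[of y]] by (intro tendsto_intros)
  have "?\<phi> \<longlonglongrightarrow> of_real (exp (- y))"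
  proof (rule LIMSEQ_I)
    fix e :: real assume e: "e > 0"
    have "\<forall>\<^sub>F K in sequentially. dist (P K) (exp (- y)) < e / 4"
      using Plim e by (intro tendstoD) auto
    moreover have "\<forall>\<^sub>F K in sequentially. dist (2 * (y ^ K /\<^sub>R fact K)) (2 * 0) < e / 4"
      using tail e by (intro tendstoD) auto
    ultimately have "\<forall>\<^sub>F K in sequentially.
        dist (P K) (exp (- y)) < e / 4 \<and> dist (2 * (y ^ K /\<^sub>R fact K)) (2 * 0) < e / 4"
      by eventually_elim auto
    then obtain K where K: "dist (P K) (exp (- y)) < e / 4" "dist (2 * (y ^ K /\<^sub>R fact K)) (2 * 0) < e / 4"
      unfolding eventually_sequentially by blast
    have "\<forall>\<^sub>F n in sequentially. dist (Q K n) (of_real (P K)) < e / 4"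
      using Qlim e by (intro tendstoD) auto
    moreover have "\<forall>\<^sub>F n in sequentially. dist (R K n) (2 * (y ^ K /\<^sub>R fact K)) < e / 4"
      using Rlim e by (intro tendstoD) auto
    ultimately have "\<forall>\<^sub>F n in sequentially. norm (?\<phi> n - of_real (exp (- y))) < e"
    proof eventually_elim
      case (elim n)
      have "norm (?\<phi> n - of_real (exp (- y)))
          \<le> norm (?\<phi> n - Q K n) + norm (Q K n - of_real (P K)) + norm (of_real (P K) - of_real (exp (- y)) :: complex)"
        using norm_triangle_ineq[of "?\<phi> n - Q K n" "Q K n - of_real (P K)"]
          norm_triangle_ineq[of "?\<phi> n - of_real (P K)" "of_real (P K) - of_real (exp (- y))"] by simp
      also have "norm (of_real (P K) - of_real (exp (- y)) :: complex) = dist (P K) (exp (- y))"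
        by (simp add: dist_norm flip: of_real_diff)
      finally show ?case
        using approx[of n K] elim K e unfolding dist_norm by (simp add: abs_if split: if_splits)
    qed
    then show "\<exists>no. \<forall>n\<ge>no. norm (?\<phi> n - of_real (exp (- y))) < e"
      by (simp add: eventually_sequentially)
  qed
  then show "?\<phi> \<longlonglongrightarrow> char (normal_law v) t"
    by (simp add: char_normal_law[OF v] y_def)
qed

subsection \<open>Factorization of correlations over clusters\<close>

definition cluster :: "real \<Rightarrow> nat set \<Rightarrow> (nat \<Rightarrow> 'h::metric_space) \<Rightarrow> nat \<Rightarrow> nat set" where
  "cluster D J h i = {j \<in> J. dist (h i) (h j) \<le> D}"

text \<open>Pairwise distances avoid the interval from D to K D; for K at least 2 this makes
  ``distance at most D'' an equivalence relation, whose classes are the clusters.\<close>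

definition gap :: "real \<Rightarrow> real \<Rightarrow> nat set \<Rightarrow> (nat \<Rightarrow> 'h::metric_space) \<Rightarrow> bool" where
  "gap K D J h \<longleftrightarrow> (\<forall>i\<in>J. \<forall>j\<in>J. dist (h i) (h j) \<le> D \<or> K * D < dist (h i) (h j))"

lemma gap_mono: "gap K D J h \<Longrightarrow> I \<subseteq> J \<Longrightarrow> gap K D I h"
  unfolding gap_def by blast

lemma cluster_self: "D \<ge> 0 \<Longrightarrow> i \<in> J \<Longrightarrow> i \<in> cluster D J h i"
  by (simp add: cluster_def)

text \<open>The triangle inequality gives distance at most 2 D, hence at most K D, and the gap then
  forces it down to D.\<close>

lemma cluster_trans:
  assumes "gap K D J h" "K \<ge> 2" "D \<ge> 0" "a \<in> J" "b \<in> J"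
    and "dist (h i) (h a) \<le> D" "dist (h i) (h b) \<le> D"
  shows "dist (h a) (h b) \<le> D"
proof -
  have "dist (h a) (h b) \<le> 2 * D"
    using assms dist_triangle3[of "h a" "h b" "h i"] by linarith
  also have "\<dots> \<le> K * D"
    using assms by (intro mult_right_mono) auto
  finally show ?thesis
    using assms unfolding gap_def by force
qed

lemma cluster_eq:
  assumes "gap K D J h" "K \<ge> 2" "D \<ge> 0" "i \<in> J" "a \<in> cluster D J h i"
  shows "cluster D J h a = cluster D J h i"
proof -
  have a: "a \<in> J" "dist (h i) (h a) \<le> D"
    using assms by (auto simp: cluster_def)
  have "dist (h a) (h b) \<le> D \<longleftrightarrow> dist (h i) (h b) \<le> D" if "b \<in> J" for b
    using cluster_trans[of K D J h a b i] cluster_trans[of K D J h i b a] assms a that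
    by (auto simp: dist_commute)
  then show ?thesis
    by (auto simp: cluster_def)
qed

lemma cluster_disjoint:
  assumes "gap K D J h" "K \<ge> 2" "D \<ge> 0" "c \<in> cluster D J h ` J" "c' \<in> cluster D J h ` J" "c \<noteq> c'"
  shows "c \<inter> c' = {}"
  using assms cluster_eq[OF assms(1-3)] by (metis (no_types, lifting) Int_emptyI imageE)

lemma prod_clusters:
  fixes F :: "nat \<Rightarrow> real"
  assumes "gap K D J h" "K \<ge> 2" "D \<ge> 0" "finite J"
  shows "(\<Prod>c\<in>cluster D J h ` J. \<Prod>i\<in>c. F i) = (\<Prod>i\<in>J. F i)"
proof -
  have "\<Union>(cluster D J h ` J) = J"
    using cluster_self[OF assms(3)] unfolding cluster_def by blast
  moreover have "finite c" if "c \<in> cluster D J h ` J" for c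
    using that assms(4) by (auto simp: cluster_def)
  moreover have "\<forall>c\<in>cluster D J h ` J. \<forall>c'\<in>cluster D J h ` J. c \<noteq> c' \<longrightarrow> c \<inter> c' = {}"
    using cluster_disjoint[OF assms(1-3)] by blast
  ultimately show ?thesis
    using prod.Union_disjoint[of "cluster D J h ` J" F] by simp
qed

lemma trans_fun_trans_fun:
  assumes "group_action act"
  shows "trans_fun act g (trans_fun act h f) = trans_fun act (g + h) f"
  using assms by (auto simp: trans_fun_def group_action_def minus_add simp del: add_uminus_conv_diff)

locale mixing_system = prob_space M for M :: "'x measure" +
  fixes act :: "'h::{metric_space, second_countable_topology, group_add} \<Rightarrow> 'x \<Rightarrow> 'x"
    and A :: "('x \<Rightarrow> real) set" and N :: "nat \<Rightarrow> ('x \<Rightarrow> real) \<Rightarrow> real" and f :: "'x \<Rightarrow> real"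
  assumes left_inv_metric: "dist (g + x) (g + y) = dist x (y::'h)"
    and action: "group_action act"
    and act_measurable[measurable]: "act h \<in> M \<rightarrow>\<^sub>M M"
    and act_preserving: "distr M M (act h) = M"
    and alg: "inv_subalgebra M act A"
    and seminorms: "adm_seminorms M act A N"
    and mixing: "exp_mixing_all_orders M act A N"
    and fA: "f \<in> A"
    and mean0: "expectation f = 0"
begin

text \<open>Indexed by a set of positions in one fixed tuple, so that clusters and complements of
  pairs are handled without renumbering.\<close>

definition corr :: "nat set \<Rightarrow> (nat \<Rightarrow> 'h) \<Rightarrow> real" where
  "corr J h = (\<integral>x. (\<Prod>i\<in>J. trans_fun act (h i) f x) \<partial>M)"

section \<open>The algebra and estimates for its seminorms\<close>

lemma A_measurable: "u \<in> A \<Longrightarrow> u \<in> borel_measurable M"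
  using alg by (auto simp: inv_subalgebra_def)

lemma A_mult: "u \<in> A \<Longrightarrow> v \<in> A \<Longrightarrow> (\<lambda>x. u x * v x) \<in> A"
  using alg by (auto simp: inv_subalgebra_def)

lemma A_trans: "u \<in> A \<Longrightarrow> trans_fun act h u \<in> A"
  using alg by (auto simp: inv_subalgebra_def)

lemma A_prod:
  assumes "finite I" "I \<noteq> {}" "\<And>i. i \<in> I \<Longrightarrow> u i \<in> A"
  shows "(\<lambda>x. \<Prod>i\<in>I. u i x) \<in> A"
  using assms by (induction rule: finite_ne_induct) (auto intro: A_mult)

lemma integral_trans_fun:
  assumes "u \<in> borel_measurable M"
  shows "(\<integral>x. trans_fun act h u x \<partial>M) = (\<integral>x. u x \<partial>M)"
proof -
  have "(\<integral>x. u x \<partial>M) = (\<integral>x. u x \<partial>distr M M (act (- h)))"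
    by (simp add: act_preserving)
  also have "\<dots> = (\<integral>x. u (act (- h) x) \<partial>M)"
    using assms by (intro integral_distr) auto
  finally show ?thesis
    by (simp add: trans_fun_def)
qed

lemma N_nonneg: "1 \<le> s \<Longrightarrow> u \<in> A \<Longrightarrow> 0 \<le> N s u"
  using seminorms unfolding adm_seminorms_def by blast

lemma N_prod_nonneg: "1 \<le> s \<Longrightarrow> (\<And>i. i \<in> I \<Longrightarrow> u i \<in> A) \<Longrightarrow> 0 \<le> (\<Prod>i\<in>I. N s (u i))"
  by (intro prod_nonneg) (auto intro: N_nonneg)

lemma N_Suc_bound:
  assumes "1 \<le> s"
  shows "\<exists>C\<ge>0. \<forall>u\<in>A. N s u \<le> C * N (Suc s) u"
proof -
  obtain C where C: "\<forall>u\<in>A. N s u \<le> C * N (s + 1) u"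
    using seminorms assms unfolding adm_seminorms_def by blast
  have "N s u \<le> \<bar>C\<bar> * N (Suc s) u" if "u \<in> A" for u
  proof -
    have "N s u \<le> C * N (Suc s) u"
      using C that by simp
    also have "\<dots> \<le> \<bar>C\<bar> * N (Suc s) u"
      using that assms by (intro mult_right_mono N_nonneg) auto
    finally show ?thesis .
  qed
  then show ?thesis
    by (intro exI[of _ "\<bar>C\<bar>"]) auto
qed

lemma N_mono_bound:
  assumes "1 \<le> s" "s \<le> t"
  shows "\<exists>C\<ge>0. \<forall>u\<in>A. N s u \<le> C * N t u"
  using assms(2)
proof (induction t rule: dec_induct)
  case base
  show ?case by (intro exI[of _ 1]) auto
next
  case (step t)
  obtain C where C: "C \<ge> 0" "\<forall>u\<in>A. N s u \<le> C * N t u"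
    using step by blast
  obtain C' where C': "C' \<ge> 0" "\<forall>u\<in>A. N t u \<le> C' * N (Suc t) u"
    using N_Suc_bound[of t] assms step by auto
  have "N s u \<le> C * C' * N (Suc t) u" if "u \<in> A" for u
  proof -
    have "N s u \<le> C * N t u" using C that by blast
    also have "\<dots> \<le> C * (C' * N (Suc t) u)"
      using C C' that by (intro mult_left_mono) auto
    finally show ?thesis by simp
  qed
  then show ?case
    using C C' by (intro exI[of _ "C * C'"]) auto
qed

lemma N_mult_bound:
  assumes "1 \<le> s"
  shows "\<exists>C\<ge>0. \<forall>u\<in>A. \<forall>v\<in>A. N s (\<lambda>x. u x * v x) \<le> C * (N (Suc s) u * N (Suc s) v)"
proof -
  obtain C where C: "\<forall>u\<in>A. \<forall>v\<in>A. N s (\<lambda>x. u x * v x) \<le> C * N (s + 1) u * N (s + 1) v"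
    using seminorms assms unfolding adm_seminorms_def by blast
  have "N s (\<lambda>x. u x * v x) \<le> \<bar>C\<bar> * (N (Suc s) u * N (Suc s) v)" if "u \<in> A" "v \<in> A" for u v
  proof -
    have "N s (\<lambda>x. u x * v x) \<le> C * (N (Suc s) u * N (Suc s) v)"
      using C that by (simp add: mult.assoc)
    also have "\<dots> \<le> \<bar>C\<bar> * (N (Suc s) u * N (Suc s) v)"
      using that assms by (intro mult_right_mono mult_nonneg_nonneg N_nonneg) auto
    finally show ?thesis .
  qed
  then show ?thesis
    by (intro exI[of _ "\<bar>C\<bar>"]) auto
qed

text \<open>Each multiplication raises the degree of the seminorm by one, so n + 1 factors cost n
  degrees. The factor peeled off has been raised only once and is lifted to the common degree by
  \<open>N_mono_bound\<close>. The index set is nonempty because A is not assumed to contain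
  constants.\<close>

lemma N_prod_bound:
  assumes "1 \<le> s"
  shows "\<exists>C\<ge>0. \<forall>(I :: nat set) u. finite I \<and> card I = Suc n \<and> (\<forall>i\<in>I. u i \<in> A) \<longrightarrow>
    N s (\<lambda>x. \<Prod>i\<in>I. u i x) \<le> C * (\<Prod>i\<in>I. N (s + n) (u i))"
  using assms
proof (induction n arbitrary: s)
  case 0
  have "N s (\<lambda>x. \<Prod>i\<in>I. u i x) \<le> 1 * (\<Prod>i\<in>I. N (s + 0) (u i))"
    if "card I = Suc 0" for I :: "nat set" and u
    using that by (auto simp: card_Suc_eq)
  then show ?case by (intro exI[of _ 1]) auto
next
  case (Suc n)
  obtain C1 where C1: "C1 \<ge> 0" "\<And>u v. u \<in> A \<Longrightarrow> v \<in> A \<Longrightarrow> N s (\<lambda>x. u x * v x) \<le> C1 * (N (Suc s) u * N (Suc s) v)"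
    using N_mult_bound[OF Suc.prems] by blast
  obtain C2 where C2: "C2 \<ge> 0" "\<And>u. u \<in> A \<Longrightarrow> N (Suc s) u \<le> C2 * N (s + Suc n) u"
    using N_mono_bound[of "Suc s" "s + Suc n"] by auto
  obtain C3 where C3: "C3 \<ge> 0" "\<And>I u. finite (I :: nat set) \<Longrightarrow> card I = Suc n \<Longrightarrow> (\<And>i. i \<in> I \<Longrightarrow> u i \<in> A) \<Longrightarrow>
      N (Suc s) (\<lambda>x. \<Prod>i\<in>I. u i x) \<le> C3 * (\<Prod>i\<in>I. N (s + Suc n) (u i))"
    using Suc.IH[of "Suc s"] by (auto simp: add_Suc_shift[symmetric] simp del: add_Suc_right)
  have "N s (\<lambda>x. \<Prod>i\<in>I. u i x) \<le> C1 * C2 * C3 * (\<Prod>i\<in>I. N (s + Suc n) (u i))"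
    if I: "finite I" "card I = Suc (Suc n)" "\<And>i. i \<in> I \<Longrightarrow> u i \<in> A" for I :: "nat set" and u
  proof -
    obtain a J where J: "I = insert a J" "a \<notin> J" "card J = Suc n" "finite J"
      using I by (metis card_Suc_eq finite_insert)
    have JA: "(\<lambda>x. \<Prod>i\<in>J. u i x) \<in> A"
      using J I by (intro A_prod) auto
    have "N s (\<lambda>x. \<Prod>i\<in>I. u i x) = N s (\<lambda>x. u a x * (\<Prod>i\<in>J. u i x))"
      using J by simp
    also have "\<dots> \<le> C1 * (N (Suc s) (u a) * N (Suc s) (\<lambda>x. \<Prod>i\<in>J. u i x))"
      using J I JA by (intro C1) auto
    also have "\<dots> \<le> C1 * ((C2 * N (s + Suc n) (u a)) * (C3 * (\<Prod>i\<in>J. N (s + Suc n) (u i))))"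
      using J I JA C1(1) C2(1) C3(1) Suc.prems
      by (intro mult_left_mono mult_mono C2 C3 mult_nonneg_nonneg N_nonneg) auto
    also have "\<dots> = C1 * C2 * C3 * (\<Prod>i\<in>I. N (s + Suc n) (u i))"
      using J by (simp add: mult_ac)
    finally show ?thesis .
  qed
  then show ?case
    using C1(1) C2(1) C3(1) by (intro exI[of _ "C1 * C2 * C3"]) auto
qed

lemma N_trans_bound:
  assumes "1 \<le> s"
  shows "\<exists>\<sigma>>0. \<exists>C\<ge>0. \<forall>h. N s (trans_fun act h f) \<le> C * exp (\<sigma> * dist h 0)"
proof -
  obtain \<sigma> C where \<sigma>: "\<sigma> > 0" and C: "\<forall>u\<in>A. \<forall>h. N s (trans_fun act h u) \<le> C * exp (\<sigma> * dist h 0) * N s u"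
    using seminorms assms unfolding adm_seminorms_def by meson
  have "N s (trans_fun act h f) \<le> (\<bar>C\<bar> * N s f) * exp (\<sigma> * dist h 0)" for h
  proof -
    have "N s (trans_fun act h f) \<le> C * (N s f * exp (\<sigma> * dist h 0))"
      using C fA by (simp add: mult_ac)
    also have "\<dots> \<le> \<bar>C\<bar> * (N s f * exp (\<sigma> * dist h 0))"
      using fA assms by (intro mult_right_mono mult_nonneg_nonneg N_nonneg) auto
    finally show ?thesis by (simp add: mult_ac)
  qed
  then show ?thesis
    using \<sigma> fA assms
    by (intro exI[of _ \<sigma>] conjI exI[of _ "\<bar>C\<bar> * N s f"] mult_nonneg_nonneg N_nonneg) auto
qed

text \<open>Every factor within distance D of the identity contributes at most a constant times exp
  (\<sigma> D), so the rate of a product is its number of factors times \<sigma>. Maxima over the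
  cardinalities up to r make both constants uniform; \<open>C \<ge> 1\<close> lets powers of it be
  compared by their exponents later.\<close>

lemma N_cluster_bound:
  assumes "1 \<le> s"
  shows "\<exists>C\<ge>1. \<exists>\<tau>\<ge>0. \<forall>(I :: nat set) g D. finite I \<and> I \<noteq> {} \<and> card I \<le> r \<and> (\<forall>i\<in>I. dist (g i) 0 \<le> D) \<longrightarrow>
    N s (\<lambda>x. \<Prod>i\<in>I. trans_fun act (g i) f x) \<le> C * exp (\<tau> * D)"
proof (induction r)
  case 0
  then show ?case by (intro exI[of _ 1]) auto
next
  case (Suc r)
  obtain C \<tau> where C: "C \<ge> 1" and \<tau>: "\<tau> \<ge> 0"
    and IH: "\<forall>(I :: nat set) g D. finite I \<and> I \<noteq> {} \<and> card I \<le> r \<and> (\<forall>i\<in>I. dist (g i) 0 \<le> D) \<longrightarrow>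
      N s (\<lambda>x. \<Prod>i\<in>I. trans_fun act (g i) f x) \<le> C * exp (\<tau> * D)"
    using Suc by blast
  obtain C1 where C1: "C1 \<ge> 0" "\<forall>(I :: nat set) u. finite I \<and> card I = Suc r \<and> (\<forall>i\<in>I. u i \<in> A) \<longrightarrow>
      N s (\<lambda>x. \<Prod>i\<in>I. u i x) \<le> C1 * (\<Prod>i\<in>I. N (s + r) (u i))"
    using N_prod_bound[OF assms, of r] by blast
  obtain \<sigma> C2 where \<sigma>: "\<sigma> > 0" and C2: "C2 \<ge> 0"
    "\<And>h. N (s + r) (trans_fun act h f) \<le> C2 * exp (\<sigma> * dist h 0)"
    using N_trans_bound[of "s + r"] assms by auto
  define C' where "C' = max C (C1 * C2 ^ Suc r)"
  define \<tau>' where "\<tau>' = max \<tau> (Suc r * \<sigma>)"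
  have "N s (\<lambda>x. \<Prod>i\<in>I. trans_fun act (g i) f x) \<le> C' * exp (\<tau>' * D)"
    if I: "finite I" "I \<noteq> {}" "card I \<le> Suc r" "\<And>i. i \<in> I \<Longrightarrow> dist (g i) 0 \<le> D" for I :: "nat set" and g D
  proof -
    have D: "D \<ge> 0"
      using I by (metis all_not_in_conv order_trans zero_le_dist)
    have up: "C * exp (\<tau> * D) \<le> C' * exp (\<tau>' * D)"
      "C1 * C2 ^ Suc r * exp (Suc r * \<sigma> * D) \<le> C' * exp (\<tau>' * D)"
      using D C C1(1) C2(1) unfolding C'_def \<tau>'_def
      by (intro mult_mono; auto intro!: mult_right_mono)+
    show ?thesis
    proof (cases "card I = Suc r")
      case True
      have "N s (\<lambda>x. \<Prod>i\<in>I. trans_fun act (g i) f x)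
          \<le> C1 * (\<Prod>i\<in>I. N (s + r) (trans_fun act (g i) f))"
        using I True by (intro C1(2)[rule_format]) (auto intro: A_trans fA)
      also have "\<dots> \<le> C1 * (\<Prod>i\<in>I. C2 * exp (\<sigma> * D))"
      proof (intro mult_left_mono prod_mono conjI C1(1))
        fix i assume i: "i \<in> I"
        show "0 \<le> N (s + r) (trans_fun act (g i) f)"
          using assms by (intro N_nonneg A_trans fA) auto
        have "N (s + r) (trans_fun act (g i) f) \<le> C2 * exp (\<sigma> * dist (g i) 0)" by (rule C2)
        also have "\<dots> \<le> C2 * exp (\<sigma> * D)"
          using i I C2(1) \<sigma> by (intro mult_left_mono) auto
        finally show "N (s + r) (trans_fun act (g i) f) \<le> C2 * exp (\<sigma> * D)" .
      qed
      also have "\<dots> = C1 * C2 ^ Suc r * exp (Suc r * \<sigma> * D)"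
        by (simp add: True power_mult_distrib exp_of_nat_mult[symmetric] mult.assoc del: power_Suc of_nat_Suc)
      finally show ?thesis using up by linarith
    next
      case False
      then have "N s (\<lambda>x. \<Prod>i\<in>I. trans_fun act (g i) f x) \<le> C * exp (\<tau> * D)"
        using I by (intro IH[rule_format]) auto
      then show ?thesis using up by linarith
    qed
  qed
  moreover have "C' \<ge> 1" "\<tau>' \<ge> 0"
    using C \<tau> by (auto simp: C'_def \<tau>'_def)
  ultimately show ?case
    by (intro exI[of _ C'] exI[of _ \<tau>'] conjI allI impI) auto
qed

text \<open>Clusters supply a lower bound \<open>L\<close> for the distances and not their minimum.
  The constant is made nonnegative so that the right-hand side is monotone in the seminorms.\<close>

lemma mixing_separated:
  assumes "2 \<le> q"
  shows "\<exists>\<delta>>0. \<exists>s0. \<forall>s>s0. \<exists>C\<ge>0. \<forall>u (g :: nat \<Rightarrow> 'h) L. (\<forall>i<q. u i \<in> A) \<and>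
      (\<forall>i<q. \<forall>j<q. i \<noteq> j \<longrightarrow> L \<le> dist (g i) (g j)) \<longrightarrow>
      \<bar>(\<integral>x. (\<Prod>i<q. trans_fun act (g i) (u i) x) \<partial>M) - (\<Prod>i<q. \<integral>x. u i x \<partial>M)\<bar>
        \<le> C * exp (- \<delta> * L) * (\<Prod>i<q. N s (u i))"
proof -
  obtain \<delta> s0 where \<delta>: "\<delta> > 0" and mix: "\<And>s. s > s0 \<Longrightarrow> \<exists>C::real.
        \<forall>(u :: nat \<Rightarrow> 'x \<Rightarrow> real) (g :: nat \<Rightarrow> 'h). (\<forall>i<q. u i \<in> A) \<longrightarrow>
          \<bar>(\<integral>x. (\<Prod>i<q. trans_fun act (g i) (u i) x) \<partial>M) - (\<Prod>i<q. \<integral>x. u i x \<partial>M)\<bar>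
            \<le> C * exp (- \<delta> * Min {dist (g i) (g j) | i j. i < q \<and> j < q \<and> i \<noteq> j})
                * (\<Prod>i<q. N s (u i))"
    using mixing assms unfolding exp_mixing_all_orders_def by meson
  have "\<exists>C\<ge>0. \<forall>u (g :: nat \<Rightarrow> 'h) L. (\<forall>i<q. u i \<in> A) \<and>
      (\<forall>i<q. \<forall>j<q. i \<noteq> j \<longrightarrow> L \<le> dist (g i) (g j)) \<longrightarrow>
      \<bar>(\<integral>x. (\<Prod>i<q. trans_fun act (g i) (u i) x) \<partial>M) - (\<Prod>i<q. \<integral>x. u i x \<partial>M)\<bar>
        \<le> C * exp (- \<delta> * L) * (\<Prod>i<q. N s (u i))" if s: "s > s0" for s
  proof -
    obtain C where C: "\<And>u g. (\<And>i. i < q \<Longrightarrow> u i \<in> A) \<Longrightarrow>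
          \<bar>(\<integral>x. (\<Prod>i<q. trans_fun act (g i) (u i) x) \<partial>M) - (\<Prod>i<q. \<integral>x. u i x \<partial>M)\<bar>
            \<le> C * exp (- \<delta> * Min {dist (g i) (g j) | i j. i < q \<and> j < q \<and> i \<noteq> j})
                * (\<Prod>i<q. N s (u i))"
      using mix[OF s] by blast
    have "\<bar>(\<integral>x. (\<Prod>i<q. trans_fun act (g i) (u i) x) \<partial>M) - (\<Prod>i<q. \<integral>x. u i x \<partial>M)\<bar>
        \<le> \<bar>C\<bar> * exp (- \<delta> * L) * (\<Prod>i<q. N s (u i))"
      if u: "\<And>i. i < q \<Longrightarrow> u i \<in> A" and g: "\<And>i j. i < q \<Longrightarrow> j < q \<Longrightarrow> i \<noteq> j \<Longrightarrow> L \<le> dist (g i) (g j)" for u g L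
    proof -
      let ?S = "{dist (g i) (g j) | i j. i < q \<and> j < q \<and> i \<noteq> j}"
      have "?S \<subseteq> (\<lambda>(i, j). dist (g i) (g j)) ` ({..<q} \<times> {..<q})" by auto
      then have "finite ?S" by (rule finite_subset) auto
      moreover have "dist (g 0) (g 1) \<in> ?S"
        using assms by (intro CollectI exI[of _ 0] exI[of _ 1]) auto
      ultimately have "L \<le> Min ?S"
        using g by (subst Min_ge_iff) auto
      then have e: "exp (- \<delta> * Min ?S) \<le> exp (- \<delta> * L)"
        using \<delta> by simp
      have P: "0 \<le> (\<Prod>i<q. N s (u i))"
        using s u by (intro N_prod_nonneg) auto
      have "\<bar>(\<integral>x. (\<Prod>i<q. trans_fun act (g i) (u i) x) \<partial>M) - (\<Prod>i<q. \<integral>x. u i x \<partial>M)\<bar>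
            \<le> C * exp (- \<delta> * Min ?S) * (\<Prod>i<q. N s (u i))"
        by (rule C[OF u])
      also have "\<dots> \<le> \<bar>C\<bar> * exp (- \<delta> * L) * (\<Prod>i<q. N s (u i))"
        using e P by (intro mult_right_mono mult_mono) auto
      finally show ?thesis .
    qed
    then show ?thesis by (intro exI[of _ "\<bar>C\<bar>"]) auto
  qed
  with \<delta> show ?thesis by blast
qed

text \<open>The number of clusters varies with the tuple, so the rate and the degree must serve all
  numbers of factors up to r. The rate is a minimum of rates; \<open>0 \<le> L\<close> makes the
  bound monotone in it.\<close>

lemma mixing_uniform:
  "\<exists>\<delta>>0. \<exists>s0. \<forall>s>s0. \<exists>C\<ge>0. \<forall>q u (g :: nat \<Rightarrow> 'h) L. 2 \<le> q \<and> q \<le> r \<and> 0 \<le> L \<and> (\<forall>i<q. u i \<in> A) \<and>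
      (\<forall>i<q. \<forall>j<q. i \<noteq> j \<longrightarrow> L \<le> dist (g i) (g j)) \<longrightarrow>
      \<bar>(\<integral>x. (\<Prod>i<q. trans_fun act (g i) (u i) x) \<partial>M) - (\<Prod>i<q. \<integral>x. u i x \<partial>M)\<bar>
        \<le> C * exp (- \<delta> * L) * (\<Prod>i<q. N s (u i))"
proof (induction r)
  case 0
  show ?case by (intro exI[of _ 1]) auto
next
  case (Suc r)
  show ?case
  proof (cases "2 \<le> Suc r")
    case False
    then show ?thesis by (intro exI[of _ 1]) auto
  next
    case True
    let ?d = "\<lambda>q u (g :: nat \<Rightarrow> 'h). \<bar>(\<integral>x. (\<Prod>i<q. trans_fun act (g i) (u i) x) \<partial>M) - (\<Prod>i<q. \<integral>x. u i x \<partial>M)\<bar>"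
    obtain \<delta>1 s1 where \<delta>1: "\<delta>1 > 0" and m1: "\<And>s. s > s1 \<Longrightarrow> \<exists>C\<ge>0. \<forall>q u (g :: nat \<Rightarrow> 'h) L. 2 \<le> q \<and> q \<le> r \<and> 0 \<le> L \<and> (\<forall>i<q. u i \<in> A) \<and>
      (\<forall>i<q. \<forall>j<q. i \<noteq> j \<longrightarrow> L \<le> dist (g i) (g j)) \<longrightarrow> ?d q u g \<le> C * exp (- \<delta>1 * L) * (\<Prod>i<q. N s (u i))"
      using Suc by blast
    obtain \<delta>2 s2 where \<delta>2: "\<delta>2 > 0" and m2: "\<And>s. s > s2 \<Longrightarrow> \<exists>C\<ge>0. \<forall>u (g :: nat \<Rightarrow> 'h) L. (\<forall>i<Suc r. u i \<in> A) \<and>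
      (\<forall>i<Suc r. \<forall>j<Suc r. i \<noteq> j \<longrightarrow> L \<le> dist (g i) (g j)) \<longrightarrow> ?d (Suc r) u g \<le> C * exp (- \<delta>2 * L) * (\<Prod>i<Suc r. N s (u i))"
      using mixing_separated[OF True] by blast
    define \<delta> where "\<delta> = min \<delta>1 \<delta>2"
    have "\<exists>C\<ge>0. \<forall>q u (g :: nat \<Rightarrow> 'h) L. 2 \<le> q \<and> q \<le> Suc r \<and> 0 \<le> L \<and> (\<forall>i<q. u i \<in> A) \<and>
      (\<forall>i<q. \<forall>j<q. i \<noteq> j \<longrightarrow> L \<le> dist (g i) (g j)) \<longrightarrow> ?d q u g \<le> C * exp (- \<delta> * L) * (\<Prod>i<q. N s (u i))"
      if s: "s > max s1 s2" for s
    proof -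
      obtain C1 where C1: "C1 \<ge> 0" "\<And>q u g L. 2 \<le> q \<Longrightarrow> q \<le> r \<Longrightarrow> 0 \<le> L \<Longrightarrow> (\<And>i. i < q \<Longrightarrow> u i \<in> A) \<Longrightarrow>
        (\<And>i j. i < q \<Longrightarrow> j < q \<Longrightarrow> i \<noteq> j \<Longrightarrow> L \<le> dist (g i) (g j)) \<Longrightarrow> ?d q u g \<le> C1 * exp (- \<delta>1 * L) * (\<Prod>i<q. N s (u i))"
        using m1[of s] s by auto
      obtain C2 where C2: "C2 \<ge> 0" "\<And>u g L. (\<And>i. i < Suc r \<Longrightarrow> u i \<in> A) \<Longrightarrow>
        (\<And>i j. i < Suc r \<Longrightarrow> j < Suc r \<Longrightarrow> i \<noteq> j \<Longrightarrow> L \<le> dist (g i) (g j)) \<Longrightarrow> ?d (Suc r) u g \<le> C2 * exp (- \<delta>2 * L) * (\<Prod>i<Suc r. N s (u i))"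
        using m2[of s] s by (auto simp del: prod.lessThan_Suc)
      have "?d q u g \<le> max C1 C2 * exp (- \<delta> * L) * (\<Prod>i<q. N s (u i))"
        if q: "2 \<le> q" "q \<le> Suc r" and L: "0 \<le> L" and u: "\<And>i. i < q \<Longrightarrow> u i \<in> A"
          and g: "\<And>i j. i < q \<Longrightarrow> j < q \<Longrightarrow> i \<noteq> j \<Longrightarrow> L \<le> dist (g i) (g j)" for q u g L
      proof -
        have P: "0 \<le> (\<Prod>i<q. N s (u i))"
          using s u by (intro N_prod_nonneg) auto
        have e: "exp (- \<delta>1 * L) \<le> exp (- \<delta> * L)" "exp (- \<delta>2 * L) \<le> exp (- \<delta> * L)"
          using L by (auto simp: \<delta>_def intro: mult_right_mono)
        show ?thesis
        proof (cases "q = Suc r")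
          case True
          have "?d q u g \<le> C2 * exp (- \<delta>2 * L) * (\<Prod>i<q. N s (u i))"
            using u g C2(2)[of u L g] unfolding True by blast
          also have "\<dots> \<le> max C1 C2 * exp (- \<delta> * L) * (\<Prod>i<q. N s (u i))"
            using e C1(1) P by (intro mult_right_mono mult_mono) auto
          finally show ?thesis .
        next
          case False
          then have "?d q u g \<le> C1 * exp (- \<delta>1 * L) * (\<Prod>i<q. N s (u i))"
            using u g q L by (intro C1(2)) auto
          also have "\<dots> \<le> max C1 C2 * exp (- \<delta> * L) * (\<Prod>i<q. N s (u i))"
            using e C1(1) P by (intro mult_right_mono mult_mono) auto
          finally show ?thesis .
        qed
      qed
      then show ?thesis
        using C1(1) by (intro exI[of _ "max C1 C2"]) auto
    qed
    moreover have "\<delta> > 0" using \<delta>1 \<delta>2 by (simp add: \<delta>_def)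
    ultimately show ?thesis by blast
  qed
qed

text \<open>Mixing is applied with one function per cluster, the product of the translates of f in
  it. \<open>C\<close> and \<open>K\<close> are fixed before the scale D, which will be chosen anew
  for every tuple.\<close>

lemma corr_factorization:
  "\<exists>C\<ge>0. \<exists>K\<ge>2. \<forall>J h D. finite J \<and> card J \<le> r \<and> D \<ge> 0 \<and> gap K D J h \<longrightarrow>
     \<bar>corr J h - (\<Prod>c\<in>cluster D J h ` J. corr c h)\<bar> \<le> C * exp (- D)"
proof -
  obtain \<delta> s0 where \<delta>: "\<delta> > 0" and m: "\<And>s. s > s0 \<Longrightarrow> \<exists>C\<ge>0. \<forall>q u (g :: nat \<Rightarrow> 'h) L. 2 \<le> q \<and> q \<le> r \<and> 0 \<le> L \<and> (\<forall>i<q. u i \<in> A) \<and>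
      (\<forall>i<q. \<forall>j<q. i \<noteq> j \<longrightarrow> L \<le> dist (g i) (g j)) \<longrightarrow>
      \<bar>(\<integral>x. (\<Prod>i<q. trans_fun act (g i) (u i) x) \<partial>M) - (\<Prod>i<q. \<integral>x. u i x \<partial>M)\<bar>
        \<le> C * exp (- \<delta> * L) * (\<Prod>i<q. N s (u i))"
    using mixing_uniform by blast
  define s where "s = Suc s0"
  obtain C1 where C1: "C1 \<ge> 0" "\<And>q u (g :: nat \<Rightarrow> 'h) L. 2 \<le> q \<Longrightarrow> q \<le> r \<Longrightarrow> 0 \<le> L \<Longrightarrow> (\<And>i. i < q \<Longrightarrow> u i \<in> A) \<Longrightarrow>
      (\<And>i j. i < q \<Longrightarrow> j < q \<Longrightarrow> i \<noteq> j \<Longrightarrow> L \<le> dist (g i) (g j)) \<Longrightarrow>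
      \<bar>(\<integral>x. (\<Prod>i<q. trans_fun act (g i) (u i) x) \<partial>M) - (\<Prod>i<q. \<integral>x. u i x \<partial>M)\<bar>
        \<le> C1 * exp (- \<delta> * L) * (\<Prod>i<q. N s (u i))"
    using m[of s] by (auto simp: s_def)
  obtain C2 \<tau> where C2: "C2 \<ge> 1" and \<tau>: "\<tau> \<ge> 0"
    and N_le: "\<And>I g D. finite (I :: nat set) \<Longrightarrow> I \<noteq> {} \<Longrightarrow> card I \<le> r \<Longrightarrow> (\<And>i. i \<in> I \<Longrightarrow> dist (g i) 0 \<le> D) \<Longrightarrow>
      N s (\<lambda>x. \<Prod>i\<in>I. trans_fun act (g i) f x) \<le> C2 * exp (\<tau> * D)"
    using N_cluster_bound[of s r] by (auto simp: s_def)
  \<comment> \<open>For this K the mixing rate at separation K D beats the growth of at most r cluster seminorms.\<close>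
  define K where "K = max 2 ((\<tau> * r + 1) / \<delta>)"
  have K: "K \<ge> 2" "\<delta> * K \<ge> \<tau> * r + 1"
    using \<delta> by (auto simp: K_def max_def field_simps)
  have "\<bar>corr J h - (\<Prod>c\<in>cluster D J h ` J. corr c h)\<bar> \<le> C1 * C2 ^ r * exp (- D)"
    if J: "finite J" "card J \<le> r" and D: "D \<ge> 0" and gap: "gap K D J h" for J h D
  proof -
    define \<C> where "\<C> = cluster D J h ` J"
    define q where "q = card \<C>"
    have fin: "finite \<C>" using J by (simp add: \<C>_def)
    have qr: "q \<le> r"
      unfolding q_def \<C>_def using card_image_le[OF J(1)] J(2) le_trans by blast
    note gK = gap K(1) D
    have c: "finite c" "c \<noteq> {}" "c \<subseteq> J" "card c \<le> r" if "c \<in> \<C>" for c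
    proof -
      show "c \<subseteq> J" using that by (auto simp: \<C>_def cluster_def)
      then show "finite c" "card c \<le> r"
        using J card_mono[of J c] by (auto intro: finite_subset)
      show "c \<noteq> {}" using that cluster_self[OF D] by (auto simp: \<C>_def)
    qed
    have bnd: "0 \<le> C1 * C2 ^ r * exp (- D)" using C1(1) C2 by simp
    \<comment> \<open>Mixing speaks of at least two factors only. With no cluster or a single one,
      the two sides of the factorization coincide.\<close>
    consider "\<C> = {}" | "q = 1" | "q \<ge> 2"
      using fin unfolding q_def by (metis card_gt_0_iff less_one linorder_not_less nat_less_le less_2_cases_iff)
    then show ?thesis
    proof cases
      case 1
      then have "J = {}" by (simp add: \<C>_def)
      then show ?thesis using bnd by (simp add: corr_def prob_space)
    next
      case 2
      then obtain c0 where "\<C> = {c0}" by (auto simp: q_def card_1_singleton_iff)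
      moreover have "\<Union>\<C> = J"
        using cluster_self[OF D] unfolding \<C>_def cluster_def by blast
      ultimately show ?thesis using bnd unfolding \<C>_def by auto
    next
      case 3
      obtain e where e: "bij_betw e {..<q} \<C>"
        using ex_bij_betw_nat_finite[OF fin] by (auto simp: q_def atLeast0LessThan)
      have eC: "e k \<in> \<C>" if "k < q" for k
        using e that by (auto simp: bij_betw_def)
      \<comment> \<open>Each cluster is pulled back by one of its own points. By left invariance its
        points then lie within D of the identity, so its seminorm is governed by its diameter and
        not by its position in the group.\<close>
      define rep where "rep k = (SOME i. i \<in> e k)" for k
      have rep: "rep k \<in> e k" if "k < q" for k
        unfolding rep_def using c(2)[OF eC[OF that]] by (auto intro: someI_ex)
      define g where "g k = h (rep k)" for k
      define u where "u k = (\<lambda>x. \<Prod>i\<in>e k. trans_fun act (- g k + h i) f x)" for k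
      have uA: "u k \<in> A" if "k < q" for k
        unfolding u_def using c[OF eC[OF that]] by (intro A_prod A_trans fA) auto
      have close: "dist (- g k + h i) 0 \<le> D" if ki: "k < q" "i \<in> e k" for k i
      proof -
        obtain a where a: "a \<in> J" "e k = cluster D J h a"
          using eC[OF ki(1)] by (auto simp: \<C>_def)
        have "dist (h i) (g k) \<le> D"
          unfolding g_def using ki rep[OF ki(1)] a
          by (intro cluster_trans[OF gK, of i "rep k" a]) (auto simp: cluster_def)
        moreover have "dist (- g k + h i) 0 = dist (h i) (g k)"
          using left_inv_metric[of "g k" "- g k + h i" 0] by (simp add: add.assoc[symmetric])
        ultimately show ?thesis by simp
      qed
      have far: "K * D \<le> dist (g k) (g l)" if ki: "k < q" "l < q" "k \<noteq> l" for k l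
      proof (rule ccontr)
        assume "\<not> ?thesis"
        moreover have kl: "rep k \<in> J" "rep l \<in> J"
          using rep c(3) eC ki by blast+
        ultimately have "dist (h (rep k)) (h (rep l)) \<le> D"
          using gap unfolding gap_def g_def by force
        then have "rep l \<in> cluster D J h (rep k)"
          using kl by (simp add: cluster_def)
        moreover obtain a where a: "a \<in> J" "e k = cluster D J h a"
          using eC[OF ki(1)] by (auto simp: \<C>_def)
        ultimately have "rep l \<in> e k"
          using cluster_eq[OF gK, of a "rep k"] rep[OF ki(1)] by simp
        moreover have "e k \<noteq> e l"
          using e ki by (auto simp: bij_betw_def inj_on_def)
        ultimately show False
          using cluster_disjoint[OF gK, of "e k" "e l"] rep[OF ki(2)] eC ki unfolding \<C>_def by blast
      qed
      have tr_u: "trans_fun act (g k) (u k) x = (\<Prod>i\<in>e k. trans_fun act (h i) f x)" for k x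
      proof -
        have "trans_fun act (g k) (u k) x = (\<Prod>i\<in>e k. trans_fun act (g k) (trans_fun act (- g k + h i) f) x)"
          by (simp add: u_def trans_fun_def)
        then show ?thesis
          by (simp add: trans_fun_trans_fun[OF action] add.assoc[symmetric])
      qed
      have "(\<Prod>k<q. trans_fun act (g k) (u k) x) = (\<Prod>i\<in>J. trans_fun act (h i) f x)" for x
      proof -
        have "(\<Prod>k<q. trans_fun act (g k) (u k) x) = (\<Prod>c\<in>\<C>. \<Prod>i\<in>c. trans_fun act (h i) f x)"
          unfolding tr_u by (rule prod.reindex_bij_betw[OF e])
        then show ?thesis
          unfolding \<C>_def using prod_clusters[OF gK J(1)] by simp
      qed
      then have 1: "(\<integral>x. (\<Prod>k<q. trans_fun act (g k) (u k) x) \<partial>M) = corr J h"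
        by (simp add: corr_def)
      have "(\<integral>x. u k x \<partial>M) = corr (e k) h" if "k < q" for k
        using integral_trans_fun[OF A_measurable[OF uA[OF that]], of "g k"]
        by (simp add: tr_u corr_def)
      then have "(\<Prod>k<q. \<integral>x. u k x \<partial>M) = (\<Prod>k<q. corr (e k) h)" by simp
      then have 2: "(\<Prod>k<q. \<integral>x. u k x \<partial>M) = (\<Prod>c\<in>\<C>. corr c h)"
        using prod.reindex_bij_betw[OF e, of "\<lambda>c. corr c h"] by simp
      have KD: "0 \<le> K * D" using K D by simp
      have "\<bar>corr J h - (\<Prod>c\<in>\<C>. corr c h)\<bar> \<le> C1 * exp (- \<delta> * (K * D)) * (\<Prod>k<q. N s (u k))"
        unfolding 1[symmetric] 2[symmetric] using 3 qr KD uA far by (intro C1(2)) auto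
      also have "\<dots> \<le> C1 * exp (- \<delta> * (K * D)) * (\<Prod>k<q. C2 * exp (\<tau> * D))"
      proof (intro mult_left_mono prod_mono conjI)
        fix k assume "k \<in> {..<q}"
        then have k: "k < q" by simp
        show "0 \<le> N s (u k)" using uA[OF k] by (intro N_nonneg) (auto simp: s_def)
        show "N s (u k) \<le> C2 * exp (\<tau> * D)"
          unfolding u_def using c[OF eC[OF k]] close[OF k] by (intro N_le) auto
      qed (use C1(1) in auto)
      also have "\<dots> = C1 * C2 ^ q * exp (\<tau> * q * D - \<delta> * K * D)"
        by (simp add: power_mult_distrib exp_of_nat_mult[symmetric] exp_diff exp_minus field_simps)
      also have "\<dots> \<le> C1 * C2 ^ r * exp (- D)"
      proof (intro mult_mono)
        show "C2 ^ q \<le> C2 ^ r" using C2 qr by (intro power_increasing) auto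
        have "\<tau> * q * D + D \<le> (\<tau> * r + 1) * D"
          using qr \<tau> D by (simp add: algebra_simps mult_left_mono mult_right_mono)
        also have "\<dots> \<le> \<delta> * K * D" using K D by (intro mult_right_mono) auto
        finally show "exp (\<tau> * q * D - \<delta> * K * D) \<le> exp (- D)" by simp
      qed (use C1(1) C2 in auto)
      finally show ?thesis unfolding \<C>_def .
    qed
  qed
  moreover have "0 \<le> C1 * C2 ^ r" using C1(1) C2 by simp
  ultimately show ?thesis
    using K(1) by (intro exI[of _ "C1 * C2 ^ r"] exI[of _ K] conjI allI impI) auto
qed

end

subsection \<open>Recursion for correlations\<close>

text \<open>A scale without a gap yields a pair of indices whose distance lies in the band from K^k
  D to K^(k+1) D. The bands are disjoint, so the r^2 + 1 scales would need as many different pairs,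
  but there are at most r^2.\<close>

lemma exists_gap_scale:
  fixes h :: "nat \<Rightarrow> 'h::metric_space"
  assumes "finite J" "card J \<le> r" "K \<ge> 1" "D \<ge> 0"
  shows "\<exists>k\<le>r * r. gap K (K ^ k * D) J h"
proof (rule ccontr)
  assume "\<not> ?thesis"
  then have no: "\<not> gap K (K ^ k * D) J h" if "k \<le> r * r" for k
    using that by blast
  have "\<forall>k\<in>{..r * r}. \<exists>p. p \<in> J \<times> J \<and> K ^ k * D < dist (h (fst p)) (h (snd p)) \<and>
      dist (h (fst p)) (h (snd p)) \<le> K ^ Suc k * D"
  proof
    fix k assume "k \<in> {..r * r}"
    then obtain i j where "i \<in> J" "j \<in> J" "K ^ k * D < dist (h i) (h j)" "dist (h i) (h j) \<le> K * (K ^ k * D)"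
      using no[of k] unfolding gap_def by (auto simp: not_le not_less)
    then show "\<exists>p. p \<in> J \<times> J \<and> K ^ k * D < dist (h (fst p)) (h (snd p)) \<and>
        dist (h (fst p)) (h (snd p)) \<le> K ^ Suc k * D"
      by (intro exI[of _ "(i, j)"]) (auto simp: mult.assoc)
  qed
  from bchoice[OF this] obtain p where p: "\<And>k. k \<le> r * r \<Longrightarrow> p k \<in> J \<times> J"
    "\<And>k. k \<le> r * r \<Longrightarrow> K ^ k * D < dist (h (fst (p k))) (h (snd (p k)))"
    "\<And>k. k \<le> r * r \<Longrightarrow> dist (h (fst (p k))) (h (snd (p k))) \<le> K ^ Suc k * D"
    by auto
  have neq: "p k \<noteq> p l" if "k < l" "l \<le> r * r" for k l
  proof
    assume "p k = p l"
    then have "K ^ l * D < K ^ Suc k * D"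
      using p(2)[of l] p(3)[of k] that by simp
    moreover have "K ^ Suc k * D \<le> K ^ l * D"
      using assms that by (intro mult_right_mono power_increasing) auto
    ultimately show False by simp
  qed
  have "inj_on p {..r * r}"
    by (rule linorder_inj_onI) (use neq in auto)
  then have "card {..r * r} \<le> card (J \<times> J)"
    by (rule card_inj_on_le) (use assms(1) p(1) in blast)+
  moreover have "card (J \<times> J) \<le> r * r"
    using assms by (simp add: card_cartesian_product mult_mono)
  ultimately show False by simp
qed

text \<open>Taking out a whole cluster leaves the others intact. This matches the factorization of
  the tuple without its first pair with the remaining factors of the full tuple.\<close>

lemma cluster_remove:
  assumes "gap K D J h" "K \<ge> 2" "D \<ge> 0" "i \<in> J"
  defines "c \<equiv> cluster D J h i"
  shows "cluster D (J - c) h ` (J - c) = cluster D J h ` J - {c}"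
proof -
  have 1: "cluster D (J - c) h a = cluster D J h a" if "a \<in> J - c" for a
  proof -
    have "cluster D J h a \<noteq> c"
      using that cluster_self[OF assms(3)] by auto
    then have "cluster D J h a \<inter> c = {}"
      using cluster_disjoint[OF assms(1-3)] that assms(4) unfolding c_def by blast
    then show ?thesis by (auto simp: cluster_def)
  qed
  have 2: "cluster D J h a = c \<longleftrightarrow> a \<in> c" if "a \<in> J" for a
    using cluster_eq[OF assms(1-4)] cluster_self[OF assms(3) that] unfolding c_def by blast
  have "cluster D (J - c) h ` (J - c) = cluster D J h ` (J - c)"
    using 1 by (intro image_cong) auto
  also have "\<dots> = cluster D J h ` J - {c}"
    using 2 by blast
  finally show ?thesis .
qed

text \<open>Each index is sent to the representative of its cluster, in the case that all clusters have at
  least two points and one of them has at least three.\<close>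

definition retractions :: "nat \<Rightarrow> (nat \<Rightarrow> nat) set" where
  "retractions r = {\<rho> \<in> {..<r} \<rightarrow>\<^sub>E {..<r}. (\<forall>i<r. \<rho> (\<rho> i) = \<rho> i) \<and> 2 * card (\<rho> ` {..<r}) + 1 \<le> r}"

definition near :: "real \<Rightarrow> 'h::metric_space \<Rightarrow> 'h \<Rightarrow> real" where
  "near R g h = (if dist g h \<le> R then 1 else 0)"

lemma near_range: "0 \<le> near R g h" "near R g h \<le> 1"
  by (auto simp: near_def)

lemma finite_retractions: "finite (retractions r)"
  unfolding retractions_def by (rule finite_subset[of _ "{..<r} \<rightarrow>\<^sub>E {..<r}"]) (auto intro: finite_PiE)

text \<open>The retraction sends an index to the least element of its cluster. For q clusters the
  sizes add up to at least 3 + 2 (q - 1), whence 2 q + 1 is at most r. Summing over all retractions,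
  and using a radius \<open>R\<close> above the scale, gives a bound that no longer depends on which
  clusters occur.\<close>

lemma cluster_retraction:
  assumes gap: "gap K D {..<r} h" "K \<ge> 2" "D \<ge> 0" and R: "D \<le> R"
    and two: "\<And>i. i < r \<Longrightarrow> 2 \<le> card (cluster D {..<r} h i)"
    and three: "0 < r" "3 \<le> card (cluster D {..<r} h 0)"
  shows "1 \<le> (\<Sum>\<rho>\<in>retractions r. \<Prod>i<r. near R (h i) (h (\<rho> i)))"
proof -
  define cl where "cl = cluster D {..<r} h"
  define \<rho> where "\<rho> = (\<lambda>i\<in>{..<r}. Min (cl i))"
  have fin: "finite (cl i)" for i by (auto simp: cl_def cluster_def)
  have mem: "\<rho> i \<in> cl i" if "i < r" for i
  proof -
    have "cl i \<noteq> {}"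
      using that cluster_self[OF gap(3), of i "{..<r}" h] by (auto simp: cl_def)
    then show ?thesis
      using that Min_in[OF fin] by (simp add: \<rho>_def)
  qed
  have less: "\<rho> i < r" if "i < r" for i
    using mem[OF that] by (auto simp: cl_def cluster_def)
  have "\<rho> (\<rho> i) = \<rho> i" if "i < r" for i
  proof -
    have "cl (\<rho> i) = cl i"
      unfolding cl_def using mem[OF that] that by (intro cluster_eq[OF gap]) (auto simp: cl_def)
    then show ?thesis using less[OF that] that by (simp add: \<rho>_def)
  qed
  moreover have "2 * card (\<rho> ` {..<r}) + 1 \<le> r"
  proof -
    have "\<Union>(cl ` {..<r}) = {..<r}"
      using cluster_self[OF gap(3)] unfolding cl_def cluster_def by blast
    then have "r = card (\<Union>(cl ` {..<r}))" by simp
    also have "\<dots> = (\<Sum>c\<in>cl ` {..<r}. card c)"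
      using cluster_disjoint[OF gap] fin
      by (intro card_Union_disjoint) (auto simp: pairwise_def disjnt_def cl_def)
    also have "\<dots> = card (cl 0) + (\<Sum>c\<in>cl ` {..<r} - {cl 0}. card c)"
      using three by (intro sum.remove) auto
    also have "\<dots> \<ge> 3 + (\<Sum>c\<in>cl ` {..<r} - {cl 0}. 2)"
      using two three by (intro add_mono sum_mono) (auto simp: cl_def)
    finally have "3 + (\<Sum>c\<in>cl ` {..<r} - {cl 0}. 2) \<le> r" .
    moreover have "(\<Sum>c\<in>cl ` {..<r} - {cl 0}. 2) = 2 * (card (cl ` {..<r}) - 1)"
      using three by simp
    moreover have "\<rho> ` {..<r} = Min ` (cl ` {..<r})"
      by (auto simp: \<rho>_def)
    then have "card (\<rho> ` {..<r}) \<le> card (cl ` {..<r})"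
      by (simp add: card_image_le)
    ultimately show ?thesis by linarith
  qed
  ultimately have \<rho>: "\<rho> \<in> retractions r"
    using less by (auto simp: retractions_def \<rho>_def)
  have "near R (h i) (h (\<rho> i)) = 1" if "i < r" for i
    using mem[OF that] R by (auto simp: near_def cl_def cluster_def)
  then have "1 = (\<Prod>i<r. near R (h i) (h (\<rho> i)))" by simp
  also have "\<dots> \<le> (\<Sum>\<rho>\<in>retractions r. \<Prod>i<r. near R (h i) (h (\<rho> i)))"
    using \<rho> by (intro member_le_sum finite_retractions) (auto intro!: prod_nonneg near_range)
  finally show ?thesis .
qed

context mixing_system
begin

section \<open>Truncation of f and the recursion for a fixed tuple\<close>

lemma f_measurable[measurable]: "f \<in> borel_measurable M"
  by (rule A_measurable[OF fA])

lemma f_AE_bounded: "\<exists>B\<ge>1. AE x in M. \<bar>f x\<bar> \<le> B"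
proof -
  obtain C where "\<forall>u\<in>A. AE x in M. \<bar>u x\<bar> \<le> C * N 1 u"
    using seminorms unfolding adm_seminorms_def by blast
  then have "AE x in M. \<bar>f x\<bar> \<le> C * N 1 f" using fA by blast
  then have "AE x in M. \<bar>f x\<bar> \<le> max 1 (C * N 1 f)"
    by eventually_elim auto
  then show ?thesis by (intro exI[of _ "max 1 (C * N 1 f)"]) auto
qed

text \<open>Members of the algebra are only almost everywhere bounded; the truncation makes the integrands
  in Fubini's theorem bounded everywhere without changing any correlation.\<close>

definition bd :: real where "bd = (SOME B. 1 \<le> B \<and> (AE x in M. \<bar>f x\<bar> \<le> B))"

definition fb :: "'x \<Rightarrow> real" where "fb x = (if \<bar>f x\<bar> \<le> bd then f x else 0)"

lemma bd: "1 \<le> bd" "AE x in M. \<bar>f x\<bar> \<le> bd"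
  using someI_ex[OF f_AE_bounded] unfolding bd_def by auto

lemma fb_measurable[measurable]: "fb \<in> borel_measurable M"
  unfolding fb_def by measurable

lemma fb_bounded: "\<bar>fb x\<bar> \<le> bd"
  using bd(1) by (auto simp: fb_def)

text \<open>The null set where f exceeds its bound is moved by the action, which preserves the
  measure. The null set obtained depends on h.\<close>

lemma AE_trans_fb: "AE x in M. trans_fun act h f x = fb (act (- h) x)"
proof -
  have "AE x in distr M M (act (- h)). f x = fb x"
    unfolding act_preserving using bd(2) by eventually_elim (simp add: fb_def)
  then show ?thesis
    by (subst (asm) AE_distr_iff) (auto simp: trans_fun_def)
qed

lemma corr_fb:
  assumes "finite J"
  shows "corr J h = (\<integral>x. (\<Prod>i\<in>J. fb (act (- h i) x)) \<partial>M)"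
proof -
  have "AE x in M. \<forall>i\<in>J. trans_fun act (h i) f x = fb (act (- h i) x)"
    using assms by (intro AE_finite_allI AE_trans_fb)
  then have "AE x in M. (\<Prod>i\<in>J. trans_fun act (h i) f x) = (\<Prod>i\<in>J. fb (act (- h i) x))"
    by eventually_elim auto
  moreover have "(\<lambda>x. trans_fun act (h i) f x) \<in> borel_measurable M" for i
    by (intro A_measurable A_trans fA)
  ultimately show ?thesis
    unfolding corr_def by (intro integral_cong_AE) (auto intro!: borel_measurable_prod)
qed

lemma prod_fb_bounded: "finite J \<Longrightarrow> \<bar>\<Prod>i\<in>J. fb (y i)\<bar> \<le> bd ^ card J"
  unfolding abs_prod using prod_mono[of J "\<lambda>i. \<bar>fb (y i)\<bar>" "\<lambda>_. bd"] fb_bounded by simp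

lemma corr_bounded:
  assumes "finite J" "card J \<le> r"
  shows "\<bar>corr J h\<bar> \<le> bd ^ r"
proof -
  have "\<bar>corr J h\<bar> \<le> (\<integral>x. \<bar>\<Prod>i\<in>J. fb (act (- h i) x)\<bar> \<partial>M)"
    unfolding corr_fb[OF assms(1)] by (rule integral_abs_bound)
  also have "\<dots> \<le> (\<integral>x. bd ^ r \<partial>M)"
  proof (rule integral_mono)
    have le: "\<bar>\<Prod>i\<in>J. fb (act (- h i) x)\<bar> \<le> bd ^ r" for x
      using prod_fb_bounded[OF assms(1), of "\<lambda>i. act (- h i) x"] power_increasing[OF assms(2) bd(1)]
      by linarith
    then show "\<bar>\<Prod>i\<in>J. fb (act (- h i) x)\<bar> \<le> bd ^ r" for x .
    show "integrable M (\<lambda>x. \<bar>\<Prod>i\<in>J. fb (act (- h i) x)\<bar>)"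
      using le by (intro integrable_const_bound[of _ "bd ^ r"]) auto
  qed auto
  finally show ?thesis by (simp add: prob_space)
qed

lemma corr_singleton: "corr {i} h = 0"
  unfolding corr_def by (simp add: integral_trans_fun mean0)

text \<open>At the scale found by pigeonhole there are three cases: some point is alone, the first
  point is in a cluster of two, or all clusters have two points and that of the first has three. In
  the first two the correlation and the sum agree up to exp (- D); in the third they are merely
  bounded.\<close>

lemma corr_recursion:
  assumes r: "0 < r"
  shows "\<exists>C\<ge>0. \<exists>L\<ge>0. \<forall>h. \<forall>D\<ge>0.
    \<bar>corr {..<r} h - (\<Sum>j\<in>{1..<r}. corr {0, j} h * corr ({1..<r} - {j}) h)\<bar>
      \<le> C * (exp (- D) + (\<Sum>\<rho>\<in>retractions r. \<Prod>i<r. near (L * D) (h i) (h (\<rho> i))))"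
proof -
  obtain C K where C: "C \<ge> 0" and K: "K \<ge> 2"
    and fact: "\<And>J h D. finite J \<Longrightarrow> card J \<le> r \<Longrightarrow> D \<ge> 0 \<Longrightarrow> gap K D J h \<Longrightarrow>
      \<bar>corr J h - (\<Prod>c\<in>cluster D J h ` J. corr c h)\<bar> \<le> C * exp (- D)"
    using corr_factorization[of r] by auto
  define P where "P = bd ^ r"
  have P: "P \<ge> 1" unfolding P_def using bd(1) by simp
  \<comment> \<open>The ratio of the largest scale that the pigeonhole argument can return to the
    initial one.\<close>
  define L where "L = K ^ (r * r)"
  \<comment> \<open>The terms with C pay for the factorization errors in the first two cases, the
    last two for the trivial bound in the third.\<close>
  define C' where "C' = C + P * C + r * (P * C) + P + r * (P * P)"
  let ?S = "\<lambda>h. (\<Sum>j\<in>{1..<r}. corr {0, j} h * corr ({1..<r} - {j}) h)"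
  let ?b = "\<lambda>D h. (\<Sum>\<rho>\<in>retractions r. \<Prod>i<r. near (L * D) (h i) (h (\<rho> i)))"
  have "\<bar>corr {..<r} h - ?S h\<bar> \<le> C' * (exp (- D0) + ?b D0 h)" if D0: "D0 \<ge> 0" for h D0
  proof -
    obtain k where k: "k \<le> r * r" "gap K (K ^ k * D0) {..<r} h"
      using exists_gap_scale[of "{..<r}" r K D0 h] K D0 by auto
    define D where "D = K ^ k * D0"
    have D: "D0 \<le> D" "D \<ge> 0" "D \<le> L * D0" and gap: "gap K D {..<r} h"
      using K D0 k mult_right_mono[of 1 "K ^ k" D0] one_le_power[of K k]
      by (auto simp: D_def L_def intro!: mult_right_mono power_increasing)
    define \<epsilon> where "\<epsilon> = C * exp (- D0)"
    have \<epsilon>: "\<epsilon> \<ge> 0" "C * exp (- D) \<le> \<epsilon>"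
      using C D by (auto simp: \<epsilon>_def intro: mult_left_mono)
    have b0: "?b D0 h \<ge> 0"
      by (intro sum_nonneg prod_nonneg) (auto intro: near_range)
    have sub: "finite I" "card I \<le> r" "gap K D I h" if "I \<subseteq> {..<r}" for I
      using that gap_mono[OF gap that] card_mono[OF _ that] by (auto intro: finite_subset)
    have bdd: "\<bar>corr I h\<bar> \<le> P" if "I \<subseteq> {..<r}" for I
      unfolding P_def using sub[OF that] by (intro corr_bounded)
    have fact': "\<bar>corr I h - (\<Prod>c\<in>cluster D I h ` I. corr c h)\<bar> \<le> \<epsilon>" if "I \<subseteq> {..<r}" for I
      using fact[of I D h] sub[OF that] D(2) \<epsilon>(2) by linarith
    have isolated: "\<bar>corr I h\<bar> \<le> \<epsilon>" if "I \<subseteq> {..<r}" "i \<in> I" "cluster D I h i = {i}" for I i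
    proof -
      have "{i} \<in> cluster D I h ` I"
        using that by (metis imageI)
      then have "(\<Prod>c\<in>cluster D I h ` I. corr c h) = 0"
        using sub[OF that(1)] corr_singleton[of i h] by (intro prod_zero bexI[of _ "{i}"]) auto
      then show ?thesis using fact'[OF that(1)] by simp
    qed
    have T: "{0, j} \<subseteq> {..<r}" "{1..<r} - {j} \<subseteq> {..<r}" if "j \<in> {1..<r}" for j
      using that by auto
    have T_le: "\<bar>corr {0, j} h * corr ({1..<r} - {j}) h\<bar> \<le> P * P" if "j \<in> {1..<r}" for j
      unfolding abs_mult using bdd T[OF that] P by (intro mult_mono) auto
    have sum_le: "\<bar>\<Sum>j\<in>I. t j\<bar> \<le> r * B" if "I \<subseteq> {1..<r}" "\<And>j. j \<in> I \<Longrightarrow> \<bar>t j\<bar> \<le> B" "B \<ge> 0" for I and B :: real and t :: "nat \<Rightarrow> real"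
    proof -
      have "\<bar>\<Sum>j\<in>I. t j\<bar> \<le> card I * B"
        by (rule order_trans[OF sum_abs sum_bounded_above]) (rule that(2))
      also have "\<dots> \<le> r * B"
        using card_mono[OF _ that(1)] that(3) by (intro mult_right_mono) auto
      finally show ?thesis .
    qed
    have PC: "0 \<le> P * C" "0 \<le> r * (P * C)" "0 \<le> P * P" "0 \<le> r * (P * P)" "0 \<le> P * \<epsilon>" using P C \<epsilon>(1) by auto
    consider (single) i where "i < r" "cluster D {..<r} h i = {i}"
      | (pair) j where "j \<in> {1..<r}" "cluster D {..<r} h 0 = {0, j}"
      | (big) "\<And>i. i < r \<Longrightarrow> cluster D {..<r} h i \<noteq> {i}"
          "\<And>j. j \<in> {1..<r} \<Longrightarrow> cluster D {..<r} h 0 \<noteq> {0, j}"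
      by blast
    then have "\<bar>corr {..<r} h - ?S h\<bar> \<le> C' * exp (- D0) \<or> \<bar>corr {..<r} h - ?S h\<bar> \<le> C' * ?b D0 h"
    proof cases
      case single
      \<comment> \<open>A point alone in the whole tuple is alone in every part that contains it. In
        each term of the sum one of the two factors contains this point and is small; the other is
        bounded by \<open>P\<close>.\<close>
      have clI: "cluster D I h i = {i}" if "I \<subseteq> {..<r}" "i \<in> I" for I
        using that single by (auto simp: cluster_def)
      have "\<bar>corr {0, j} h * corr ({1..<r} - {j}) h\<bar> \<le> P * \<epsilon>" if j: "j \<in> {1..<r}" for j
      proof (cases "i \<in> {0, j}")
        case True
        then have "\<bar>corr {0, j} h\<bar> \<le> \<epsilon>"
          using isolated[OF T(1)[OF j] True] clI[OF T(1)[OF j]] by blast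
        then show ?thesis
          unfolding abs_mult using bdd[OF T(2)[OF j]] P \<epsilon>(1)
          by (subst mult.commute) (intro mult_mono, auto)
      next
        case False
        then have i: "i \<in> {1..<r} - {j}" using single by auto
        have "\<bar>corr ({1..<r} - {j}) h\<bar> \<le> \<epsilon>"
          using isolated[OF T(2)[OF j] i] clI[OF T(2)[OF j] i] by blast
        then show ?thesis
          unfolding abs_mult using bdd[OF T(1)[OF j]] P \<epsilon>(1) by (intro mult_mono) auto
      qed
      then have "\<bar>?S h\<bar> \<le> r * (P * \<epsilon>)"
        using PC by (intro sum_le) auto
      moreover have "\<bar>corr {..<r} h\<bar> \<le> \<epsilon>"
        using single by (intro isolated[of _ i]) auto
      ultimately have "\<bar>corr {..<r} h - ?S h\<bar> \<le> (C + r * (P * C)) * exp (- D0)"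
        unfolding \<epsilon>_def by (simp add: algebra_simps)
      also have "\<dots> \<le> C' * exp (- D0)"
        unfolding C'_def using P PC by (intro mult_right_mono) auto
      finally show ?thesis by simp
    next
      case pair
      have rest: "{1..<r} - {j} = {..<r} - {0, j}" by auto
      let ?\<C> = "cluster D {..<r} h ` {..<r}"
      have mem: "{0, j} \<in> ?\<C>"
        using pair r by (metis imageI lessThan_iff)
      \<comment> \<open>Both the full correlation and the product of the correlations of the pair
        and of the rest are close to the same product over clusters, so they are close to each
        other.\<close>
      have "cluster D ({..<r} - {0, j}) h ` ({..<r} - {0, j}) = ?\<C> - {{0, j}}"
        using cluster_remove[OF gap K D(2), of 0] pair r by simp
      then have "\<bar>corr ({1..<r} - {j}) h - (\<Prod>c\<in>?\<C> - {{0, j}}. corr c h)\<bar> \<le> \<epsilon>"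
        using fact'[OF T(2)[OF pair(1)]] unfolding rest by simp
      then have "\<bar>corr {0, j} h\<bar> * \<bar>corr ({1..<r} - {j}) h - (\<Prod>c\<in>?\<C> - {{0, j}}. corr c h)\<bar> \<le> P * \<epsilon>"
        using bdd[OF T(1)[OF pair(1)]] P by (intro mult_mono) auto
      then have 1: "\<bar>corr {0, j} h * corr ({1..<r} - {j}) h - (\<Prod>c\<in>?\<C>. corr c h)\<bar> \<le> P * \<epsilon>"
        using mem by (subst prod.remove[OF _ mem]) (auto simp: abs_mult[symmetric] right_diff_distrib)
      have 2: "\<bar>corr {..<r} h - (\<Prod>c\<in>?\<C>. corr c h)\<bar> \<le> \<epsilon>"
        by (intro fact') auto
      \<comment> \<open>Any other index \<open>j'\<close> lies outside the cluster of 0, so 0 is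
        isolated in {0, j'} and this term is negligible.\<close>
      have "\<bar>corr {0, j'} h * corr ({1..<r} - {j'}) h\<bar> \<le> P * \<epsilon>" if j': "j' \<in> {1..<r} - {j}" for j'
      proof -
        have j'': "j' \<in> {1..<r}" using j' by simp
        have "j' \<notin> cluster D {..<r} h 0" using pair j' by auto
        then have "cluster D {0, j'} h 0 = {0}"
          using j' D(2) by (auto simp: cluster_def)
        then have "\<bar>corr {0, j'} h\<bar> \<le> \<epsilon>"
          by (intro isolated[OF T(1)[OF j''], of 0]) auto
        then show ?thesis
          unfolding abs_mult using bdd[OF T(2)[OF j'']] P \<epsilon>(1)
          by (subst mult.commute) (intro mult_mono, auto)
      qed
      then have "\<bar>\<Sum>j'\<in>{1..<r} - {j}. corr {0, j'} h * corr ({1..<r} - {j'}) h\<bar> \<le> r * (P * \<epsilon>)"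
        using PC by (intro sum_le) auto
      moreover have "?S h = corr {0, j} h * corr ({1..<r} - {j}) h
          + (\<Sum>j'\<in>{1..<r} - {j}. corr {0, j'} h * corr ({1..<r} - {j'}) h)"
        using pair by (intro sum.remove) auto
      ultimately have "\<bar>corr {..<r} h - ?S h\<bar> \<le> \<epsilon> + P * \<epsilon> + r * (P * \<epsilon>)"
        using 1 2 by linarith
      also have "\<dots> = (C + P * C + r * (P * C)) * exp (- D0)"
        unfolding \<epsilon>_def by (simp add: algebra_simps)
      also have "\<dots> \<le> C' * exp (- D0)"
        unfolding C'_def using P PC by (intro mult_right_mono) auto
      finally show ?thesis by simp
    next
      case big
      let ?c = "cluster D {..<r} h"
      have fin: "finite (?c i)" for i by (auto simp: cluster_def)
      have two: "2 \<le> card (?c i)" if i: "i < r" for i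
      proof -
        have self: "i \<in> ?c i" using D(2) i by (intro cluster_self) auto
        then obtain j where "j \<in> ?c i" "j \<noteq> i" using big(1)[OF i] by blast
        then have "card {i, j} \<le> card (?c i)" using self fin by (intro card_mono) auto
        then show ?thesis using \<open>j \<noteq> i\<close> by simp
      qed
      have "card (?c 0) \<noteq> 2"
      proof
        assume "card (?c 0) = 2"
        moreover have "0 \<in> ?c 0" using D(2) r by (intro cluster_self) auto
        ultimately obtain j where j: "?c 0 = {0, j}" "j \<noteq> 0"
          by (auto simp: card_2_iff doubleton_eq_iff)
        moreover have "j \<in> {1..<r}" using j by (auto simp: cluster_def)
        ultimately show False using big(2) by blast
      qed
      then have "3 \<le> card (?c 0)"
        using two[OF r] by simp
      \<comment> \<open>No cancellation is available here. Since the sum over retractions is at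
        least 1, it turns the trivial bound into one that will be integrated.\<close>
      then have "1 \<le> ?b D0 h"
        using two r by (intro cluster_retraction[OF gap K D(2,3)]) auto
      moreover have "\<bar>?S h\<bar> \<le> r * (P * P)"
        using PC T_le by (intro sum_le) auto
      then have "\<bar>corr {..<r} h - ?S h\<bar> \<le> C'"
        unfolding C'_def using bdd[OF order_refl] PC C by linarith
      moreover have "0 \<le> C'" unfolding C'_def using PC C P by simp
      ultimately have "\<bar>corr {..<r} h - ?S h\<bar> \<le> C' * ?b D0 h"
        using mult_left_mono[of 1 "?b D0 h" C'] by simp
      then show ?thesis by simp
    qed
    moreover have C'0: "0 \<le> C'" unfolding C'_def using PC C P by simp
    have "0 \<le> C' * ?b D0 h" "0 \<le> C' * exp (- D0)"
      using b0 C'0 by (intro mult_nonneg_nonneg; simp)+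
    ultimately show ?thesis
      unfolding distrib_left by linarith
  qed
  moreover have "0 \<le> C'" unfolding C'_def using C P by simp
  moreover have "0 \<le> L" unfolding L_def using K by simp
  ultimately show ?thesis by (intro exI[of _ C'] exI[of _ L] conjI allI impI) auto
qed

end

subsection \<open>Integration over tuples\<close>

lemma borel_measurable_near[measurable]:
  assumes [measurable]: "u \<in> borel_measurable P" "w \<in> borel_measurable P"
  shows "(\<lambda>x. near R (u x) (w x :: 'h::{metric_space, second_countable_topology})) \<in> borel_measurable P"
  unfolding near_def by measurable

lemma finite_measure_PiM:
  assumes "finite_measure \<nu>" "finite I"
  shows "finite_measure (PiM I (\<lambda>_. \<nu>))"
proof -
  interpret \<nu>: finite_measure \<nu> by fact
  interpret product_sigma_finite "\<lambda>_. \<nu>" by standard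
  show ?thesis
  proof (rule finite_measureI)
    have "emeasure (PiM I (\<lambda>_. \<nu>)) (space (PiM I (\<lambda>_. \<nu>))) = (\<Prod>i\<in>I. emeasure \<nu> (space \<nu>))"
      unfolding space_PiM using assms(2) by (intro emeasure_PiM) auto
    also have "\<dots> \<noteq> \<infinity>"
      by (simp add: power_eq_top_ennreal)
    finally show "emeasure (PiM I (\<lambda>_. \<nu>)) (space (PiM I (\<lambda>_. \<nu>))) \<noteq> \<infinity>" .
  qed
qed

text \<open>The parameter z will be a point of X for the moments, and a pair of points for a product
  of two correlations; for the latter \<open>G\<close> must depend on the index. Boundedness and
  finite measures supply integrability.\<close>

lemma integral_PiM_prod_swap:
  fixes G :: "'i \<Rightarrow> 'a \<Rightarrow> 'z \<Rightarrow> real"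
  assumes \<nu>: "finite_measure \<nu>" and P: "finite_measure P" and I: "finite I"
    and meas: "\<And>i. i \<in> I \<Longrightarrow> (\<lambda>(h, z). G i h z) \<in> borel_measurable (\<nu> \<Otimes>\<^sub>M P)"
    and bounded: "\<And>i h z. \<bar>G i h z\<bar> \<le> B"
  shows "(\<integral>h. (\<integral>z. (\<Prod>i\<in>I. G i (h i) z) \<partial>P) \<partial>PiM I (\<lambda>_. \<nu>)) = (\<integral>z. (\<Prod>i\<in>I. \<integral>h. G i h z \<partial>\<nu>) \<partial>P)"
    and "integrable (PiM I (\<lambda>_. \<nu>)) (\<lambda>h. \<integral>z. (\<Prod>i\<in>I. G i (h i) z) \<partial>P)"
proof -
  interpret \<nu>: finite_measure \<nu> by fact
  interpret P: finite_measure P by fact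
  interpret product_sigma_finite "\<lambda>_. \<nu>" by standard
  interpret \<Pi>: finite_measure "PiM I (\<lambda>_. \<nu>)" by (rule finite_measure_PiM[OF \<nu> I])
  interpret pair: pair_sigma_finite "PiM I (\<lambda>_. \<nu>)" P by standard
  interpret pairf: finite_measure "PiM I (\<lambda>_. \<nu>) \<Otimes>\<^sub>M P"
    by (intro finite_measure_pair_measure P \<Pi>.finite_measure_axioms)
  have [measurable]: "(\<lambda>p. G i (fst p i) (snd p)) \<in> borel_measurable (PiM I (\<lambda>_. \<nu>) \<Otimes>\<^sub>M P)" if "i \<in> I" for i
  proof -
    have "(\<lambda>p. (fst p i, snd p)) \<in> PiM I (\<lambda>_. \<nu>) \<Otimes>\<^sub>M P \<rightarrow>\<^sub>M \<nu> \<Otimes>\<^sub>M P"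
      using that by measurable
    from measurable_compose[OF this meas[OF that]] show ?thesis by simp
  qed
  have int: "integrable (PiM I (\<lambda>_. \<nu>) \<Otimes>\<^sub>M P) (\<lambda>(h, z). \<Prod>i\<in>I. G i (h i) z)"
  proof (rule pairf.integrable_const_bound[of _ "B ^ card I"])
    have "\<bar>\<Prod>i\<in>I. G i (h i) z\<bar> \<le> B ^ card I" for h z
      unfolding abs_prod using prod_mono[of I "\<lambda>i. \<bar>G i (h i) z\<bar>" "\<lambda>_. B"] bounded by simp
    then show "AE p in PiM I (\<lambda>_. \<nu>) \<Otimes>\<^sub>M P. norm (case p of (h, z) \<Rightarrow> \<Prod>i\<in>I. G i (h i) z) \<le> B ^ card I"
      by auto
    show "(\<lambda>(h, z). \<Prod>i\<in>I. G i (h i) z) \<in> borel_measurable (PiM I (\<lambda>_. \<nu>) \<Otimes>\<^sub>M P)"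
      unfolding split_beta' by (intro borel_measurable_prod) measurable
  qed
  then show "integrable (PiM I (\<lambda>_. \<nu>)) (\<lambda>h. \<integral>z. (\<Prod>i\<in>I. G i (h i) z) \<partial>P)"
    by (rule pair.integrable_fst)
  have "(\<integral>h. (\<integral>z. (\<Prod>i\<in>I. G i (h i) z) \<partial>P) \<partial>PiM I (\<lambda>_. \<nu>))
      = (\<integral>z. (\<integral>h. (\<Prod>i\<in>I. G i (h i) z) \<partial>PiM I (\<lambda>_. \<nu>)) \<partial>P)"
    using pair.Fubini_integral[OF int] by simp
  also have "\<dots> = (\<integral>z. (\<Prod>i\<in>I. \<integral>h. G i h z \<partial>\<nu>) \<partial>P)"
  proof (rule Bochner_Integration.integral_cong[OF refl])
    fix z assume z: "z \<in> space P"
    have "integrable \<nu> (\<lambda>h. G i h z)" if "i \<in> I" for i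
    proof (rule \<nu>.integrable_const_bound[of _ B])
      show "(\<lambda>h. G i h z) \<in> borel_measurable \<nu>"
        using measurable_compose[OF measurable_Pair2'[OF z] meas[OF that]] by simp
    qed (use bounded in auto)
    then show "(\<integral>h. (\<Prod>i\<in>I. G i (h i) z) \<partial>PiM I (\<lambda>_. \<nu>)) = (\<Prod>i\<in>I. \<integral>h. G i h z \<partial>\<nu>)"
      using product_integral_prod[OF I, of "\<lambda>i h. G i h z"] by simp
  qed
  finally show "(\<integral>h. (\<integral>z. (\<Prod>i\<in>I. G i (h i) z) \<partial>P) \<partial>PiM I (\<lambda>_. \<nu>)) = (\<integral>z. (\<Prod>i\<in>I. \<integral>h. G i h z \<partial>\<nu>) \<partial>P)" .
qed

text \<open>The points indexed by Q are integrated out one at a time. Each is tied to a base point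
  in R and to nothing else, so it contributes at most the volume of a ball, and the base points
  remain free.\<close>

lemma nn_integral_near_le:
  fixes \<nu> :: "'h::{metric_space, second_countable_topology} measure"
  assumes \<nu>: "finite_measure \<nu>" and sets[measurable_cong]: "sets \<nu> = sets borel"
    and ball: "\<And>g. emeasure \<nu> (cball g D) \<le> v"
    and fin: "finite (R :: nat set)" "finite Q" and disj: "R \<inter> Q = {}" and \<rho>: "\<rho> ` Q \<subseteq> R"
  shows "(\<integral>\<^sup>+ h. (\<Prod>i\<in>Q. ennreal (near D (h i) (h (\<rho> i)))) \<partial>PiM (R \<union> Q) (\<lambda>_. \<nu>))
    \<le> emeasure \<nu> (space \<nu>) ^ card R * v ^ card Q"
  using fin(2) disj \<rho>
proof (induction Q)
  case empty
  interpret \<nu>: finite_measure \<nu> by fact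
  interpret product_sigma_finite "\<lambda>_. \<nu>" by standard
  show ?case
    using fin(1) emeasure_PiM[of R "\<lambda>_. space \<nu>"] by (simp add: space_PiM)
next
  case (insert i Q)
  interpret \<nu>: finite_measure \<nu> by fact
  interpret product_sigma_finite "\<lambda>_. \<nu>" by standard
  have i: "i \<notin> R \<union> Q" "finite (R \<union> Q)" "\<rho> i \<in> R"
    using insert fin by auto
  let ?\<Pi> = "\<lambda>I. PiM I (\<lambda>_. \<nu>)"
  have [measurable]: "(\<lambda>h. near D (h k) (h (\<rho> k))) \<in> borel_measurable (?\<Pi> J)"
    if "k \<in> J" "\<rho> k \<in> J" for k J
  proof -
    have "(\<lambda>h. h k) \<in> borel_measurable (?\<Pi> J)" "(\<lambda>h. h (\<rho> k)) \<in> borel_measurable (?\<Pi> J)"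
      using that measurable_component_singleton[of k J "\<lambda>_. \<nu>"] measurable_component_singleton[of "\<rho> k" J "\<lambda>_. \<nu>"]
      by (simp_all add: measurable_cong_sets[OF refl sets])
    then show ?thesis by measurable
  qed
  have near1: "(\<integral>\<^sup>+ y. ennreal (near D y g) \<partial>\<nu>) \<le> v" for g
  proof -
    have "(\<integral>\<^sup>+ y. ennreal (near D y g) \<partial>\<nu>) = (\<integral>\<^sup>+ y. indicator (cball g D) y \<partial>\<nu>)"
      by (intro nn_integral_cong) (auto simp: near_def dist_commute split: split_indicator)
    also have "\<dots> = emeasure \<nu> (cball g D)"
      by (intro nn_integral_indicator) (simp add: sets)
    finally show ?thesis using ball by simp
  qed
  have "(\<integral>\<^sup>+ h. (\<Prod>k\<in>insert i Q. ennreal (near D (h k) (h (\<rho> k)))) \<partial>?\<Pi> (R \<union> insert i Q))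
      = (\<integral>\<^sup>+ h. (\<Prod>k\<in>insert i Q. ennreal (near D (h k) (h (\<rho> k)))) \<partial>?\<Pi> (insert i (R \<union> Q)))"
    by simp
  also have "\<dots> = (\<integral>\<^sup>+ x. \<integral>\<^sup>+ y. (\<Prod>k\<in>insert i Q. ennreal (near D ((x(i := y)) k) ((x(i := y)) (\<rho> k)))) \<partial>\<nu> \<partial>?\<Pi> (R \<union> Q))"
    using i insert by (intro product_nn_integral_insert borel_measurable_prod_ennreal measurable_compose[OF _ measurable_ennreal]) auto
  also have "\<dots> \<le> (\<integral>\<^sup>+ x. (\<Prod>k\<in>Q. ennreal (near D (x k) (x (\<rho> k)))) * v \<partial>?\<Pi> (R \<union> Q))"
  proof (rule nn_integral_mono)
    fix x :: "nat \<Rightarrow> 'h"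
    have upd: "(\<Prod>k\<in>insert i Q. ennreal (near D ((x(i := y)) k) ((x(i := y)) (\<rho> k))))
        = (\<Prod>k\<in>Q. ennreal (near D (x k) (x (\<rho> k)))) * ennreal (near D y (x (\<rho> i)))" for y
    proof -
      have "(\<Prod>k\<in>Q. ennreal (near D ((x(i := y)) k) ((x(i := y)) (\<rho> k)))) = (\<Prod>k\<in>Q. ennreal (near D (x k) (x (\<rho> k))))"
        using insert by (intro prod.cong) auto
      moreover have "\<rho> i \<noteq> i" using i by auto
      ultimately show ?thesis
        using insert by (simp add: mult.commute)
    qed
    have [measurable]: "(\<lambda>y. near D y (x (\<rho> i))) \<in> borel_measurable \<nu>"
      by (intro borel_measurable_near) (simp_all add: measurable_cong_sets[OF sets refl])
    show "(\<integral>\<^sup>+ y. (\<Prod>k\<in>insert i Q. ennreal (near D ((x(i := y)) k) ((x(i := y)) (\<rho> k)))) \<partial>\<nu>)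
        \<le> (\<Prod>k\<in>Q. ennreal (near D (x k) (x (\<rho> k)))) * v"
      unfolding upd using near1 by (subst nn_integral_cmult) (auto intro: mult_left_mono)
  qed
  also have "\<dots> = (\<integral>\<^sup>+ x. (\<Prod>k\<in>Q. ennreal (near D (x k) (x (\<rho> k)))) \<partial>?\<Pi> (R \<union> Q)) * v"
    using insert by (intro nn_integral_multc borel_measurable_prod_ennreal measurable_compose[OF _ measurable_ennreal]) auto
  also have "\<dots> \<le> emeasure \<nu> (space \<nu>) ^ card R * v ^ card Q * v"
    using insert by (intro mult_right_mono insert.IH) auto
  also have "\<dots> = emeasure \<nu> (space \<nu>) ^ card R * v ^ card (insert i Q)"
    using insert by (simp add: mult_ac)
  finally show ?case .
qed

lemma integral_near_retraction_le:
  fixes \<nu> :: "'h::{metric_space, second_countable_topology} measure"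
  assumes \<nu>: "finite_measure \<nu>" and sets[measurable_cong]: "sets \<nu> = sets borel"
    and ball: "\<And>g. emeasure \<nu> (cball g D) \<le> ennreal v" and v: "0 \<le> v"
    and \<rho>: "\<rho> \<in> retractions r"
  shows "integrable (PiM {..<r} (\<lambda>_. \<nu>)) (\<lambda>h. \<Prod>i<r. near D (h i) (h (\<rho> i)))"
    and "(\<integral>h. (\<Prod>i<r. near D (h i) (h (\<rho> i))) \<partial>PiM {..<r} (\<lambda>_. \<nu>))
      \<le> measure \<nu> (space \<nu>) ^ card (\<rho> ` {..<r}) * v ^ (r - card (\<rho> ` {..<r}))"
proof -
  interpret \<nu>: finite_measure \<nu> by fact
  interpret \<Pi>: finite_measure "PiM {..<r} (\<lambda>_. \<nu>)" by (rule finite_measure_PiM[OF \<nu>]) simp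
  define R where "R = \<rho> ` {..<r}"
  define Q where "Q = {..<r} - R"
  have \<rho>R: "R \<subseteq> {..<r}" "\<And>i. i < r \<Longrightarrow> \<rho> i < r"
    using \<rho> unfolding R_def retractions_def by auto
  have meas: "(\<lambda>h. near D (h i) (h (\<rho> i))) \<in> borel_measurable (PiM {..<r} (\<lambda>_. \<nu>))" if "i < r" for i
    using that \<rho>R measurable_component_singleton[of i "{..<r}" "\<lambda>_. \<nu>"]
      measurable_component_singleton[of "\<rho> i" "{..<r}" "\<lambda>_. \<nu>"]
    by (intro borel_measurable_near) (simp_all add: measurable_cong_sets[OF refl sets])
  have prod_le: "0 \<le> (\<Prod>i\<in>I. near D (h i) (h (\<rho> i)))" "(\<Prod>i\<in>I. near D (h i) (h (\<rho> i))) \<le> 1" for I and h :: "nat \<Rightarrow> 'h"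
    by (auto intro!: prod_nonneg prod_le_1 near_range)
  show int: "integrable (PiM {..<r} (\<lambda>_. \<nu>)) (\<lambda>h. \<Prod>i<r. near D (h i) (h (\<rho> i)))"
    using meas by (intro \<Pi>.integrable_const_bound[of _ 1]) (auto simp: abs_of_nonneg prod_le)
  have "ennreal (\<integral>h. (\<Prod>i<r. near D (h i) (h (\<rho> i))) \<partial>PiM {..<r} (\<lambda>_. \<nu>))
      = (\<integral>\<^sup>+ h. ennreal (\<Prod>i<r. near D (h i) (h (\<rho> i))) \<partial>PiM {..<r} (\<lambda>_. \<nu>))"
    using prod_le by (intro nn_integral_eq_integral[symmetric] int) auto
  \<comment> \<open>The factors at the base points are at most 1 and are dropped; the others tie
    each remaining point to a base point.\<close>
  also have "\<dots> \<le> (\<integral>\<^sup>+ h. (\<Prod>i\<in>Q. ennreal (near D (h i) (h (\<rho> i)))) \<partial>PiM {..<r} (\<lambda>_. \<nu>))"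
  proof (rule nn_integral_mono)
    fix h :: "nat \<Rightarrow> 'h"
    have "(\<Prod>i<r. near D (h i) (h (\<rho> i))) = (\<Prod>i\<in>R. near D (h i) (h (\<rho> i))) * (\<Prod>i\<in>Q. near D (h i) (h (\<rho> i)))"
      using \<rho>R unfolding Q_def by (subst prod.subset_diff[of R]) auto
    also have "\<dots> \<le> 1 * (\<Prod>i\<in>Q. near D (h i) (h (\<rho> i)))"
      by (intro mult_right_mono prod_le)
    finally show "ennreal (\<Prod>i<r. near D (h i) (h (\<rho> i))) \<le> (\<Prod>i\<in>Q. ennreal (near D (h i) (h (\<rho> i))))"
      by (subst prod_ennreal) (auto intro: near_range ennreal_leI)
  qed
  also have "{..<r} = R \<union> Q" using \<rho>R by (auto simp: Q_def)
  also have "(\<integral>\<^sup>+ h. (\<Prod>i\<in>Q. ennreal (near D (h i) (h (\<rho> i)))) \<partial>PiM (R \<union> Q) (\<lambda>_. \<nu>))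
      \<le> emeasure \<nu> (space \<nu>) ^ card R * ennreal v ^ card Q"
    by (rule nn_integral_near_le[OF \<nu> sets ball]) (auto simp: R_def Q_def)
  also have "\<dots> = ennreal (measure \<nu> (space \<nu>) ^ card R * v ^ card Q)"
    using v by (simp add: \<nu>.emeasure_eq_measure ennreal_mult ennreal_power)
  finally have "(\<integral>h. (\<Prod>i<r. near D (h i) (h (\<rho> i))) \<partial>PiM {..<r} (\<lambda>_. \<nu>))
      \<le> measure \<nu> (space \<nu>) ^ card R * v ^ card Q"
    using v \<rho>R by (subst (asm) ennreal_le_iff) (auto simp: Q_def Un_absorb1)
  moreover have "card Q = r - card R"
    unfolding Q_def using \<rho>R by (simp add: card_Diff_subset finite_subset)
  ultimately show "(\<integral>h. (\<Prod>i<r. near D (h i) (h (\<rho> i))) \<partial>PiM {..<r} (\<lambda>_. \<nu>))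
      \<le> measure \<nu> (space \<nu>) ^ card (\<rho> ` {..<r}) * v ^ (r - card (\<rho> ` {..<r}))"
    by (simp add: R_def)
qed

subsection \<open>Moments of orbit integrals\<close>

locale haar_mixing_system = mixing_system M act A N f
  for M :: "'x measure"
    and act :: "'h::{metric_space, second_countable_topology, group_add} \<Rightarrow> 'x \<Rightarrow> 'x"
    and A :: "('x \<Rightarrow> real) set" and N :: "nat \<Rightarrow> ('x \<Rightarrow> real) \<Rightarrow> real" and f :: "'x \<Rightarrow> real" +
  fixes m :: "'h measure"
  assumes topgrp_add: "continuous_on UNIV (\<lambda>p::'h \<times> 'h. fst p + snd p)"
    and topgrp_inv: "continuous_on UNIV (uminus :: 'h \<Rightarrow> 'h)"
    and proper_metric: "compact (cball (0::'h) r)"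
    and haar: "left_haar m"
    and subexp: "Limsup at_top (\<lambda>r. ereal (ln (measure m (ball 0 r)) / r)) = 0"
    and joint_meas: "(\<lambda>(h, x). act h x) \<in> measurable (m \<Otimes>\<^sub>M M) M"
begin

section \<open>Haar measure and the volume of balls\<close>

lemma sets_m[measurable_cong, simp]: "sets m = sets borel"
  using haar by (simp add: left_haar_def)

lemma space_m[simp]: "space m = UNIV"
  using sets_eq_imp_space_eq[OF sets_m] by simp

lemma emeasure_translate: "B \<in> sets borel \<Longrightarrow> emeasure m ((\<lambda>x. g + x) ` B) = emeasure m B"
  using haar by (auto simp: left_haar_def)

lemma emeasure_compact: "compact K \<Longrightarrow> emeasure m K < \<infinity>"
  using haar by (auto simp: left_haar_def)

definition vol :: "real \<Rightarrow> real" where "vol R = measure m (cball 0 R)"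

text \<open>Left invariance of both metric and measure moves the centre to the identity; the closed
  ball is compact, so its measure is finite.\<close>

lemma emeasure_cball: "emeasure m (cball g R) = ennreal (vol R)"
proof -
  have "(\<lambda>x. g + x) ` cball 0 R = cball g R"
  proof (intro equalityI subsetI)
    fix y assume "y \<in> cball g R"
    then have "- g + y \<in> cball 0 R"
      using left_inv_metric[of "- g" g y] by simp
    then show "y \<in> (\<lambda>x. g + x) ` cball 0 R"
      by (intro image_eqI[of _ _ "- g + y"]) (simp_all add: add.assoc[symmetric])
  qed (use left_inv_metric[of g 0] in auto)
  then have "emeasure m (cball g R) = emeasure m (cball 0 R)"
    using emeasure_translate[of "cball 0 R" g] by simp
  also have "\<dots> = ennreal (vol R)"
    unfolding vol_def using emeasure_compact[OF proper_metric[of R]] by (intro emeasure_eq_ennreal_measure) auto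
  finally show ?thesis .
qed

lemma vol_nonneg: "0 \<le> vol R"
  by (simp add: vol_def)

lemma cball_fmeasurable: "cball 0 R \<in> fmeasurable m"
  by (rule fmeasurableI) (simp_all add: emeasure_cball)

lemma vol_mono: "R \<le> R' \<Longrightarrow> vol R \<le> vol R'"
  unfolding vol_def by (intro measure_mono_fmeasurable cball_fmeasurable) auto

text \<open>The closed ball of radius R lies in the open ball of radius R + 1, to which the growth
  condition applies at the cost of a factor exp \<epsilon>. The shift also keeps the divisor
  positive. Radii below the threshold are absorbed into the constant.\<close>

lemma vol_subexp:
  assumes "\<epsilon> > 0"
  shows "\<exists>C\<ge>1. \<forall>R\<ge>0. vol R \<le> C * exp (\<epsilon> * R)"
proof -
  have "Limsup at_top (\<lambda>r. ereal (ln (measure m (ball 0 r)) / r)) < ereal \<epsilon>"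
    using assms by (simp add: subexp)
  then have "\<forall>\<^sub>F r in at_top. ereal (ln (measure m (ball 0 r)) / r) < ereal \<epsilon>"
    by (rule Limsup_lessD)
  then obtain r0 where r0: "\<And>r. r \<ge> r0 \<Longrightarrow> ln (measure m (ball 0 r)) / r < \<epsilon>"
    by (auto simp: eventually_at_top_linorder)
  have large: "vol R \<le> exp \<epsilon> * exp (\<epsilon> * R)" if R: "R \<ge> max r0 0" for R
  proof -
    have fm: "ball 0 (R + 1) \<in> fmeasurable m"
      by (rule fmeasurableI2[OF cball_fmeasurable[of "R + 1"]]) auto
    have "vol R \<le> measure m (ball 0 (R + 1))"
      unfolding vol_def using fm by (intro measure_mono_fmeasurable) auto
    also have "\<dots> \<le> exp (\<epsilon> * (R + 1))"
    proof (cases "measure m (ball 0 (R + 1)) > 0")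
      case True
      have "ln (measure m (ball 0 (R + 1))) \<le> \<epsilon> * (R + 1)"
        using r0[of "R + 1"] R by (simp add: field_simps)
      then show ?thesis
        using True by (metis exp_le_cancel_iff exp_ln)
    next
      case False
      then show ?thesis using exp_ge_zero[of "\<epsilon> * (R + 1)"] by linarith
    qed
    also have "\<dots> = exp \<epsilon> * exp (\<epsilon> * R)"
      by (simp add: exp_add[symmetric] algebra_simps)
    finally show ?thesis .
  qed
  define C where "C = max 1 (max (exp \<epsilon>) (vol (max r0 0)))"
  have "vol R \<le> C * exp (\<epsilon> * R)" if R: "R \<ge> 0" for R
  proof (cases "R \<ge> max r0 0")
    case True
    have "exp \<epsilon> * exp (\<epsilon> * R) \<le> C * exp (\<epsilon> * R)"
      by (intro mult_right_mono) (auto simp: C_def)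
    then show ?thesis using large[OF True] by linarith
  next
    case False
    then have "R \<le> max r0 0" by linarith
    then have "vol R \<le> C * 1"
      using vol_mono by (simp add: C_def le_max_iff_disj)
    also have "\<dots> \<le> C * exp (\<epsilon> * R)"
      using R assms by (intro mult_left_mono) (auto simp: C_def)
    finally show ?thesis .
  qed
  then show ?thesis
    by (intro exI[of _ C]) (auto simp: C_def)
qed

sublocale m: sigma_finite_measure m
proof
  let ?B = "range (\<lambda>n::nat. cball (0::'h) (real n))"
  have "\<Union>?B = space m"
    using real_arch_simple by auto
  then show "\<exists>B. countable B \<and> B \<subseteq> sets m \<and> \<Union>B = space m \<and> (\<forall>a\<in>B. emeasure m a \<noteq> \<infinity>)"
    by (intro exI[of _ ?B]) (auto simp: emeasure_cball)
qed

lemma measurable_uminus_borel[measurable]: "(uminus :: 'h \<Rightarrow> 'h) \<in> borel_measurable borel"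
  by (rule borel_measurable_continuous_onI[OF topgrp_inv])

text \<open>Second countability identifies the product sigma-algebra with the Borel sets of the
  product, so that continuity of the group law gives joint measurability.\<close>

lemma measurable_plus_borel[measurable]:
  assumes [measurable]: "u \<in> borel_measurable P" "w \<in> borel_measurable P"
  shows "(\<lambda>x. u x + w x :: 'h) \<in> borel_measurable P"
proof -
  have "(\<lambda>x. (u x, w x)) \<in> P \<rightarrow>\<^sub>M borel"
    unfolding borel_prod[symmetric] by measurable
  from measurable_compose[OF this borel_measurable_continuous_onI[OF topgrp_add]] show ?thesis
    by simp
qed

lemma act_uminus_measurable:
  assumes [measurable_cong]: "sets \<nu> = sets borel"
  shows "(\<lambda>p. act (- fst p) (snd p)) \<in> \<nu> \<Otimes>\<^sub>M M \<rightarrow>\<^sub>M M"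
proof -
  have "(\<lambda>p. (- fst p, snd p)) \<in> \<nu> \<Otimes>\<^sub>M M \<rightarrow>\<^sub>M m \<Otimes>\<^sub>M M"
    by measurable
  from measurable_compose[OF this joint_meas] show ?thesis by simp
qed

lemma fb_act_measurable:
  assumes "sets \<nu> = sets borel"
  shows "(\<lambda>(h, x). fb (act (- h) x)) \<in> borel_measurable (\<nu> \<Otimes>\<^sub>M M)"
  using measurable_compose[OF act_uminus_measurable[OF assms] fb_measurable] by (simp add: split_beta')

section \<open>Orbit integrals as bounded functions and their moments\<close>

definition restr :: "'h set \<Rightarrow> 'h measure" where "restr F = density m (indicator F)"

text \<open>Formed with the truncation \<open>fb\<close>, so that it is bounded everywhere by a
  multiple of the measure of F and all its moments exist. It agrees almost everywhere with the orbit
  integral of f.\<close>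

definition S :: "'h set \<Rightarrow> 'x \<Rightarrow> real" where "S F x = (\<integral>h. fb (act (- h) x) \<partial>restr F)"

lemma sets_restr[measurable_cong, simp]: "sets (restr F) = sets borel"
  by (simp add: restr_def)

lemma space_restr[simp]: "space (restr F) = UNIV"
  by (simp add: restr_def)

lemma compact_borel: "compact F \<Longrightarrow> F \<in> sets borel" for F :: "'h set"
  by (simp add: borel_closed compact_imp_closed)

lemma emeasure_restr:
  "compact F \<Longrightarrow> B \<in> sets borel \<Longrightarrow> emeasure (restr F) B = emeasure m (F \<inter> B)"
  using compact_borel[of F] by (simp add: restr_def emeasure_density indicator_inter_arith[symmetric])

lemma emeasure_restr_space: "compact F \<Longrightarrow> emeasure (restr F) UNIV = ennreal (measure m F)"
  using emeasure_compact[of F] emeasure_restr[of F UNIV] by (simp add: emeasure_eq_ennreal_measure[of m F])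

lemma finite_measure_restr: "compact F \<Longrightarrow> finite_measure (restr F)"
  by (rule finite_measureI) (simp add: emeasure_restr_space)

lemma measure_restr_space: "compact F \<Longrightarrow> measure (restr F) UNIV = measure m F"
  by (simp add: measure_def emeasure_restr_space)

lemma emeasure_restr_cball: "compact F \<Longrightarrow> emeasure (restr F) (cball g R) \<le> ennreal (vol R)"
  unfolding emeasure_cball[of g, symmetric] by (simp add: emeasure_restr emeasure_mono)

lemma integral_restr:
  fixes u :: "'h \<Rightarrow> real"
  assumes "compact F" "u \<in> borel_measurable borel"
  shows "(\<integral>h. u h \<partial>restr F) = (LINT h:F|m. u h)"
proof -
  have "restr F = density m (\<lambda>h. ennreal (indicator F h))"
    unfolding restr_def by (simp add: ennreal_indicator)
  then show ?thesis
    unfolding set_lebesgue_integral_def using assms compact_borel[of F]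
    by (simp add: integral_density)
qed

lemma fb_act_section: "x \<in> space M \<Longrightarrow> (\<lambda>h. fb (act (- h) x)) \<in> borel_measurable borel"
  using measurable_compose[OF measurable_Pair2' fb_act_measurable[OF refl]] by simp

lemma S_measurable[measurable]:
  assumes "compact F"
  shows "S F \<in> borel_measurable M"
proof -
  interpret finite_measure "restr F" by (rule finite_measure_restr[OF assms])
  have "(\<lambda>(x, h). fb (act (- h) x)) \<in> borel_measurable (M \<Otimes>\<^sub>M restr F)"
    using measurable_compose[OF measurable_pair_swap' fb_act_measurable[OF sets_restr]]
    by (simp add: split_beta')
  then show ?thesis
    unfolding S_def by (rule borel_measurable_lebesgue_integral)
qed

lemma S_bounded:
  assumes "compact F"
  shows "\<bar>S F x\<bar> \<le> bd * measure m F"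
proof -
  interpret finite_measure "restr F" by (rule finite_measure_restr[OF assms])
  have "\<bar>S F x\<bar> \<le> (\<integral>h. \<bar>fb (act (- h) x)\<bar> \<partial>restr F)"
    unfolding S_def by (rule integral_abs_bound)
  also have "\<dots> \<le> (\<integral>h. bd \<partial>restr F)"
    using fb_bounded bd(1) by (intro Bochner_Integration.integral_mono') auto
  also have "\<dots> = bd * measure m F"
    by (simp add: measure_restr_space[OF assms])
  finally show ?thesis .
qed

lemma S_power_integrable:
  assumes "compact F"
  shows "integrable M (\<lambda>x. S F x ^ k)"
proof (rule integrable_const_bound[of _ "(bd * measure m F) ^ k"])
  show "AE x in M. norm (S F x ^ k) \<le> (bd * measure m F) ^ k"
    using S_bounded[OF assms] by (intro AE_I2) (simp add: power_abs power_mono)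
qed (use S_measurable[OF assms] in auto)

lemma orbit_integral_measurable:
  assumes "compact F"
  shows "(\<lambda>x. LINT h:F|m. trans_fun act h f x) \<in> borel_measurable M"
proof -
  have [measurable]: "(\<lambda>p. act (- snd p) (fst p)) \<in> M \<Otimes>\<^sub>M m \<rightarrow>\<^sub>M M"
    using measurable_compose[OF measurable_pair_swap' act_uminus_measurable[OF sets_m]]
    by (simp add: split_beta')
  have [measurable]: "F \<in> sets borel" by (rule compact_borel[OF assms])
  have "(\<lambda>(x, h). indicator F h *\<^sub>R trans_fun act h f x) \<in> borel_measurable (M \<Otimes>\<^sub>M m)"
    unfolding trans_fun_def split_beta' by measurable
  then show ?thesis
    unfolding set_lebesgue_integral_def by (rule m.borel_measurable_lebesgue_integral)
qed

text \<open>For each h the functions agree off a null set that depends on h. Joint measurability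
  allows the two quantifiers to be exchanged: for almost every x they agree for almost every
  h.\<close>

lemma AE_orbit_integral:
  assumes "compact F"
  shows "AE x in M. (LINT h:F|m. trans_fun act h f x) = S F x"
proof -
  interpret pair: pair_sigma_finite m M by standard
  have [measurable]: "(\<lambda>p. act (- fst p) (snd p)) \<in> m \<Otimes>\<^sub>M M \<rightarrow>\<^sub>M M"
    by (rule act_uminus_measurable[OF sets_m])
  have set: "{p \<in> space (m \<Otimes>\<^sub>M M). f (act (- fst p) (snd p)) = fb (act (- fst p) (snd p))} \<in> sets (m \<Otimes>\<^sub>M M)"
    by measurable
  have "AE h in m. AE x in M. f (act (- h) x) = fb (act (- h) x)"
    using AE_trans_fb by (simp add: trans_fun_def)
  then have "AE x in M. AE h in m. f (act (- h) x) = fb (act (- h) x)"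
    using pair.AE_commute[of "\<lambda>h x. f (act (- h) x) = fb (act (- h) x)"] set by (simp add: split_beta')
  moreover have "AE x in M. x \<in> space M" by simp
  ultimately show ?thesis
  proof eventually_elim
    case (elim x)
    have fm: "(\<lambda>h. f (act (- h) x)) \<in> borel_measurable m"
      using measurable_compose[OF measurable_compose[OF measurable_Pair2'[OF elim(2)]
          act_uminus_measurable[OF sets_m]] f_measurable] by simp
    have "(LINT h:F|m. trans_fun act h f x) = (LINT h:F|m. fb (act (- h) x))"
      using elim(1) compact_borel[OF assms] fm fb_act_section[OF elim(2)]
      by (intro set_lebesgue_integral_cong_AE) (auto simp: trans_fun_def set_borel_measurable_def)
    then show ?case
      unfolding S_def by (simp add: integral_restr[OF assms fb_act_section[OF elim(2)]])
  qed
qed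

lemma integral_corr:
  assumes "compact F"
  shows "(\<integral>h. corr {..<r} h \<partial>PiM {..<r} (\<lambda>_. restr F)) = (\<integral>x. S F x ^ r \<partial>M)"
    and "integrable (PiM {..<r} (\<lambda>_. restr F)) (corr {..<r})"
proof -
  note swap = integral_PiM_prod_swap[OF finite_measure_restr[OF assms] finite_measure_axioms,
    of "{..<r}" "\<lambda>_ h x. fb (act (- h) x)" bd, OF _ fb_act_measurable[OF sets_restr] fb_bounded]
  show "(\<integral>h. corr {..<r} h \<partial>PiM {..<r} (\<lambda>_. restr F)) = (\<integral>x. S F x ^ r \<partial>M)"
    using swap(1) by (simp add: corr_fb S_def)
  have "corr {..<r} = (\<lambda>h. \<integral>x. (\<Prod>i<r. fb (act (- h i) x)) \<partial>M)"
    by (intro ext corr_fb) simp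
  then show "integrable (PiM {..<r} (\<lambda>_. restr F)) (corr {..<r})"
    using swap(2) by simp
qed

text \<open>A product of two expectations is one expectation over two independent points. The
  indices 0 and j read the first point and the others the second, so integrating over tuples gives
  the square of the orbit integral at the first times its power r - 2 at the second.\<close>

lemma integral_corr_mult:
  assumes "compact F" and j: "j \<in> {1..<r}"
  shows "(\<integral>h. corr {0, j} h * corr ({1..<r} - {j}) h \<partial>PiM {..<r} (\<lambda>_. restr F))
      = (\<integral>x. S F x ^ 2 \<partial>M) * (\<integral>x. S F x ^ (r - 2) \<partial>M)"
    and "integrable (PiM {..<r} (\<lambda>_. restr F)) (\<lambda>h. corr {0, j} h * corr ({1..<r} - {j}) h)"
proof -
  interpret pair: pair_prob_space M M by standard
  define \<pi> where "\<pi> i z = (if i \<in> {0, j} then fst z else snd z)" for i :: nat and z :: "'x \<times> 'x"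
  have [measurable]: "\<pi> i \<in> M \<Otimes>\<^sub>M M \<rightarrow>\<^sub>M M" for i
    unfolding \<pi>_def by (cases "i \<in> {0, j}") auto
  have meas: "(\<lambda>(h, z). fb (act (- h) (\<pi> i z))) \<in> borel_measurable (restr F \<Otimes>\<^sub>M (M \<Otimes>\<^sub>M M))" for i
  proof -
    have "(\<lambda>p. (fst p, \<pi> i (snd p))) \<in> restr F \<Otimes>\<^sub>M (M \<Otimes>\<^sub>M M) \<rightarrow>\<^sub>M restr F \<Otimes>\<^sub>M M"
      by measurable
    from measurable_compose[OF this fb_act_measurable[OF sets_restr]] show ?thesis
      by (simp add: split_beta')
  qed
  note swap = integral_PiM_prod_swap[OF finite_measure_restr[OF assms(1)] pair.P.finite_measure_axioms,
    of "{..<r}" "\<lambda>i h z. fb (act (- h) (\<pi> i z))" bd, OF _ meas fb_bounded]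
  have split: "{..<r} = {0, j} \<union> ({1..<r} - {j})" "{0, j} \<inter> ({1..<r} - {j}) = {}"
    using j by auto
  have prod_split: "(\<Prod>i<r. w i) = (\<Prod>i\<in>{0, j}. w i) * (\<Prod>i\<in>{1..<r} - {j}. w i)" for w :: "nat \<Rightarrow> real"
    using split by (simp only: split(1)) (intro prod.union_disjoint, auto)
  have prod_int: "(\<integral>z. u (fst z) * w (snd z) \<partial>(M \<Otimes>\<^sub>M M)) = (\<integral>x. u x \<partial>M) * (\<integral>x. w x \<partial>M)"
    if u: "u \<in> borel_measurable M" "\<And>x. \<bar>u x\<bar> \<le> B" and w: "w \<in> borel_measurable M" "\<And>x. \<bar>w x\<bar> \<le> B'"
    for u w :: "'x \<Rightarrow> real" and B B'
  proof -
    have "integrable (M \<Otimes>\<^sub>M M) (\<lambda>z. u (fst z) * w (snd z))"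
    proof (rule pair.P.integrable_const_bound[of _ "B * B'"])
      show "AE z in M \<Otimes>\<^sub>M M. norm (u (fst z) * w (snd z)) \<le> B * B'"
        using u(2) w(2) order_trans[OF abs_ge_zero u(2)] by (intro AE_I2) (auto simp: abs_mult intro!: mult_mono)
    qed (use u(1) w(1) in measurable)
    then show ?thesis
      using pair.integral_fst'[of "\<lambda>z. u (fst z) * w (snd z)"] by simp
  qed
  have "(\<integral>z. (\<Prod>i<r. fb (act (- h i) (\<pi> i z))) \<partial>(M \<Otimes>\<^sub>M M)) = corr {0, j} h * corr ({1..<r} - {j}) h" for h
  proof -
    have "(\<Prod>i\<in>{0, j}. fb (act (- h i) (\<pi> i z))) = (\<Prod>i\<in>{0, j}. fb (act (- h i) (fst z)))"
      "(\<Prod>i\<in>{1..<r} - {j}. fb (act (- h i) (\<pi> i z))) = (\<Prod>i\<in>{1..<r} - {j}. fb (act (- h i) (snd z)))" for z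
      by (auto simp: \<pi>_def intro!: prod.cong)
    then have "(\<integral>z. (\<Prod>i<r. fb (act (- h i) (\<pi> i z))) \<partial>(M \<Otimes>\<^sub>M M))
        = (\<integral>z. (\<Prod>i\<in>{0, j}. fb (act (- h i) (fst z))) * (\<Prod>i\<in>{1..<r} - {j}. fb (act (- h i) (snd z))) \<partial>(M \<Otimes>\<^sub>M M))"
      by (simp only: prod_split)
    also have "\<dots> = corr {0, j} h * corr ({1..<r} - {j}) h"
    proof -
      have 1: "corr {0, j} h = (\<integral>x. (\<Prod>i\<in>{0, j}. fb (act (- h i) x)) \<partial>M)"
        by (rule corr_fb) simp
      have 2: "corr ({1..<r} - {j}) h = (\<integral>x. (\<Prod>i\<in>{1..<r} - {j}. fb (act (- h i) x)) \<partial>M)"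
        by (rule corr_fb) simp
      show ?thesis
        unfolding 1 2
      proof (rule prod_int)
        show "\<bar>\<Prod>i\<in>{0, j}. fb (act (- h i) x)\<bar> \<le> bd ^ card {0, j}" for x
          by (rule prod_fb_bounded) simp
        show "\<bar>\<Prod>i\<in>{1..<r} - {j}. fb (act (- h i) x)\<bar> \<le> bd ^ card ({1..<r} - {j})" for x
          by (rule prod_fb_bounded) simp
      qed (intro borel_measurable_prod, measurable)+
    qed
    finally show ?thesis .
  qed
  then have corr: "(\<lambda>h. \<integral>z. (\<Prod>i<r. fb (act (- h i) (\<pi> i z))) \<partial>(M \<Otimes>\<^sub>M M))
      = (\<lambda>h. corr {0, j} h * corr ({1..<r} - {j}) h)"
    by auto
  show "integrable (PiM {..<r} (\<lambda>_. restr F)) (\<lambda>h. corr {0, j} h * corr ({1..<r} - {j}) h)"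
    using swap(2) unfolding corr by simp
  have "(\<integral>h. corr {0, j} h * corr ({1..<r} - {j}) h \<partial>PiM {..<r} (\<lambda>_. restr F))
      = (\<integral>z. (\<Prod>i<r. S F (\<pi> i z)) \<partial>(M \<Otimes>\<^sub>M M))"
    using swap(1) unfolding corr by (simp add: S_def)
  also have "(\<lambda>z. \<Prod>i<r. S F (\<pi> i z)) = (\<lambda>z. S F (fst z) ^ 2 * S F (snd z) ^ (r - 2))"
  proof
    fix z
    have "(\<Prod>i\<in>{0, j}. S F (\<pi> i z)) = (\<Prod>i\<in>{0, j}. S F (fst z))"
      "(\<Prod>i\<in>{1..<r} - {j}. S F (\<pi> i z)) = (\<Prod>i\<in>{1..<r} - {j}. S F (snd z))"
      by (auto simp: \<pi>_def intro!: prod.cong)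
    moreover have "card {0, j} = 2" "card ({1..<r} - {j}) = r - 2"
      using j by (auto simp: card_Diff_singleton)
    ultimately show "(\<Prod>i<r. S F (\<pi> i z)) = S F (fst z) ^ 2 * S F (snd z) ^ (r - 2)"
      unfolding prod_split by (simp only: prod_constant)
  qed
  also have "(\<integral>z. S F (fst z) ^ 2 * S F (snd z) ^ (r - 2) \<partial>(M \<Otimes>\<^sub>M M))
      = (\<integral>x. S F x ^ 2 \<partial>M) * (\<integral>x. S F x ^ (r - 2) \<partial>M)"
  proof (rule prod_int)
    have bound: "\<bar>S F x ^ k\<bar> \<le> (bd * measure m F) ^ k" for x k
      unfolding power_abs using S_bounded[OF assms(1)] by (intro power_mono) auto
    show "\<bar>S F x ^ 2\<bar> \<le> (bd * measure m F) ^ 2" for x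
      by (rule bound)
    show "\<bar>S F x ^ (r - 2)\<bar> \<le> (bd * measure m F) ^ (r - 2)" for x
      by (rule bound)
  qed (use S_measurable[OF assms(1)] in auto)
  finally show "(\<integral>h. corr {0, j} h * corr ({1..<r} - {j}) h \<partial>PiM {..<r} (\<lambda>_. restr F))
      = (\<integral>x. S F x ^ 2 \<partial>M) * (\<integral>x. S F x ^ (r - 2) \<partial>M)" .
qed

text \<open>The r - 1 choices of a partner for the first point have equal integrals, which is the
  origin of the factor in the recursion. D stays free, to be matched to the measure of F.\<close>

lemma moment_recursion_bound:
  assumes r: "2 \<le> r"
  shows "\<exists>C\<ge>0. \<exists>L\<ge>0. \<forall>F. \<forall>D\<ge>0. compact F \<longrightarrow>
    \<bar>(\<integral>x. S F x ^ r \<partial>M) - real (r - 1) * ((\<integral>x. S F x ^ 2 \<partial>M) * (\<integral>x. S F x ^ (r - 2) \<partial>M))\<bar>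
      \<le> C * (exp (- D) * measure m F ^ r +
        (\<Sum>\<rho>\<in>retractions r. measure m F ^ card (\<rho> ` {..<r}) * vol (L * D) ^ (r - card (\<rho> ` {..<r}))))"
proof -
  obtain C L where C: "C \<ge> 0" and L: "L \<ge> 0" and bound: "\<And>h D. D \<ge> 0 \<Longrightarrow>
      \<bar>corr {..<r} h - (\<Sum>j\<in>{1..<r}. corr {0, j} h * corr ({1..<r} - {j}) h)\<bar>
      \<le> C * (exp (- D) + (\<Sum>\<rho>\<in>retractions r. \<Prod>i<r. near (L * D) (h i) (h (\<rho> i))))"
    using corr_recursion[of r] r by auto
  have "\<bar>(\<integral>x. S F x ^ r \<partial>M) - real (r - 1) * ((\<integral>x. S F x ^ 2 \<partial>M) * (\<integral>x. S F x ^ (r - 2) \<partial>M))\<bar>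
      \<le> C * (exp (- D) * measure m F ^ r +
        (\<Sum>\<rho>\<in>retractions r. measure m F ^ card (\<rho> ` {..<r}) * vol (L * D) ^ (r - card (\<rho> ` {..<r}))))"
    if F: "compact F" and D: "D \<ge> 0" for F D
  proof -
    let ?\<Pi> = "PiM {..<r} (\<lambda>_. restr F)"
    interpret \<nu>: finite_measure "restr F" by (rule finite_measure_restr[OF F])
    interpret product_sigma_finite "\<lambda>_. restr F" by standard
    interpret \<Pi>: finite_measure ?\<Pi>
      by (intro finite_measure_PiM finite_measure_restr[OF F]) simp
    let ?T = "\<lambda>h. \<Sum>j\<in>{1..<r}. corr {0, j} h * corr ({1..<r} - {j}) h"
    let ?n = "\<lambda>\<rho> h. \<Prod>i<r. near (L * D) (h i) (h (\<rho> i))"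
    have intT: "integrable ?\<Pi> ?T"
      using integral_corr_mult(2)[OF F] by (intro Bochner_Integration.integrable_sum) auto
    have intn: "integrable ?\<Pi> (?n \<rho>)" "(\<integral>h. ?n \<rho> h \<partial>?\<Pi>) \<le> measure m F ^ card (\<rho> ` {..<r}) * vol (L * D) ^ (r - card (\<rho> ` {..<r}))"
      if "\<rho> \<in> retractions r" for \<rho>
      using integral_near_retraction_le[OF \<nu>.finite_measure_axioms sets_restr emeasure_restr_cball[OF F] vol_nonneg that]
      by (simp_all add: measure_restr_space[OF F])
    have "(\<integral>h. ?T h \<partial>?\<Pi>) = (\<Sum>j\<in>{1..<r}. (\<integral>x. S F x ^ 2 \<partial>M) * (\<integral>x. S F x ^ (r - 2) \<partial>M))"
      using integral_corr_mult[OF F, of _ r] by (subst Bochner_Integration.integral_sum) (auto intro!: sum.cong)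
    then have "(\<integral>x. S F x ^ r \<partial>M) - real (r - 1) * ((\<integral>x. S F x ^ 2 \<partial>M) * (\<integral>x. S F x ^ (r - 2) \<partial>M))
        = (\<integral>h. corr {..<r} h \<partial>?\<Pi>) - (\<integral>h. ?T h \<partial>?\<Pi>)"
      by (simp add: integral_corr(1)[OF F])
    also have "\<dots> = (\<integral>h. corr {..<r} h - ?T h \<partial>?\<Pi>)"
      by (intro Bochner_Integration.integral_diff[symmetric] integral_corr(2)[OF F] intT)
    also have "\<bar>\<dots>\<bar> \<le> (\<integral>h. C * (exp (- D) + (\<Sum>\<rho>\<in>retractions r. ?n \<rho> h)) \<partial>?\<Pi>)"
    proof (rule order_trans[OF integral_abs_bound integral_mono])
      show "integrable ?\<Pi> (\<lambda>h. \<bar>corr {..<r} h - ?T h\<bar>)"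
        by (intro integrable_abs Bochner_Integration.integrable_diff integral_corr(2)[OF F] intT)
      show "integrable ?\<Pi> (\<lambda>h. C * (exp (- D) + (\<Sum>\<rho>\<in>retractions r. ?n \<rho> h)))"
        using intn by (intro integrable_mult_right Bochner_Integration.integrable_add Bochner_Integration.integrable_sum) auto
    qed (use bound[OF D] in auto)
    also have "\<dots> = C * (exp (- D) * measure ?\<Pi> (space ?\<Pi>) + (\<Sum>\<rho>\<in>retractions r. \<integral>h. ?n \<rho> h \<partial>?\<Pi>))"
      using intn(1) by (simp add: Bochner_Integration.integral_sum mult.commute)
    also have "measure ?\<Pi> (space ?\<Pi>) = measure m F ^ r"
    proof -
      have "emeasure ?\<Pi> (space ?\<Pi>) = (\<Prod>i<r. emeasure (restr F) (space (restr F)))"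
        unfolding space_PiM by (intro emeasure_PiM) auto
      then show ?thesis
        by (simp add: measure_def emeasure_restr_space[OF F] ennreal_power)
    qed
    also have "C * (exp (- D) * measure m F ^ r + (\<Sum>\<rho>\<in>retractions r. \<integral>h. ?n \<rho> h \<partial>?\<Pi>))
        \<le> C * (exp (- D) * measure m F ^ r +
        (\<Sum>\<rho>\<in>retractions r. measure m F ^ card (\<rho> ` {..<r}) * vol (L * D) ^ (r - card (\<rho> ` {..<r}))))"
      using intn(2) C by (intro mult_left_mono add_left_mono sum_mono) auto
    finally show ?thesis .
  qed
  then show ?thesis
    using C L by (intro exI[of _ C] exI[of _ L] conjI allI impI) auto
qed

end

subsection \<open>Limits of the moments\<close>

context haar_mixing_system
begin

definition moment :: "nat \<Rightarrow> 'h set \<Rightarrow> real" where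
  "moment k F = (\<integral>x. (S F x / sqrt (measure m F)) ^ k \<partial>M)"

lemma moment_eq: "moment k F = (\<integral>x. S F x ^ k \<partial>M) / sqrt (measure m F) ^ k"
  by (simp add: moment_def power_divide)

text \<open>With V the measure of F, the error is of order V^((r - 1) / 2) times V^(1 / 4). Dividing
  by V^(r / 2) leaves V^(- 1 / 4). The second moment is kept as a function of F; its limit is found
  separately.\<close>

lemma moment_recursion_limit:
  assumes r: "2 \<le> r" and F: "\<And>T. compact (F T)"
    and big: "filterlim (\<lambda>T. measure m (F T)) at_top sequentially"
  shows "(\<lambda>T. moment r (F T) - real (r - 1) * (moment 2 (F T) * moment (r - 2) (F T))) \<longlonglongrightarrow> 0"
proof -
  obtain C L where C: "C \<ge> 0" and L: "L \<ge> 0" and bound: "\<And>F D. D \<ge> 0 \<Longrightarrow> compact F \<Longrightarrow>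
    \<bar>(\<integral>x. S F x ^ r \<partial>M) - real (r - 1) * ((\<integral>x. S F x ^ 2 \<partial>M) * (\<integral>x. S F x ^ (r - 2) \<partial>M))\<bar>
      \<le> C * (exp (- D) * measure m F ^ r +
        (\<Sum>\<rho>\<in>retractions r. measure m F ^ card (\<rho> ` {..<r}) * vol (L * D) ^ (r - card (\<rho> ` {..<r}))))"
    using moment_recursion_bound[OF r] by auto
  \<comment> \<open>A growth rate at which the r-th power of the volume of a ball of radius L r log V is at most
    a constant times the fourth root of V.\<close>
  define \<epsilon> where "\<epsilon> = 1 / (4 * r * (L * r + 1))"
  have \<epsilon>: "\<epsilon> > 0" using r L by (simp add: \<epsilon>_def add_nonneg_pos)
  have \<epsilon>_le: "r * (\<epsilon> * (L * r)) \<le> 1 / 4"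
    using r L by (simp add: \<epsilon>_def divide_simps add_nonneg_pos)
  obtain B where B: "B \<ge> 1" "\<And>R. R \<ge> 0 \<Longrightarrow> vol R \<le> B * exp (\<epsilon> * R)"
    using vol_subexp[OF \<epsilon>] by auto
  define n where "n = real (card (retractions r))"
  define K where "K = C * (1 + n * B ^ r)"
  have main: "\<bar>moment r (F T) - real (r - 1) * (moment 2 (F T) * moment (r - 2) (F T))\<bar>
      \<le> K * exp (- (1 / 4) * ln (measure m (F T)))" if V1: "measure m (F T) \<ge> 1" for T
  proof -
    define V where "V = measure m (F T)"
    define l where "l = ln V"
    define W where "W = sqrt V"
    have V: "V \<ge> 1" using V1 by (simp add: V_def)
    have l: "l \<ge> 0" "exp l = V" using V by (auto simp: l_def)
    have W: "W \<ge> 1" "W ^ 2 = V" "W = exp (l / 2)"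
      using V by (auto simp: W_def l_def ln_sqrt[symmetric] exp_ln)
    \<comment> \<open>Chosen so that the factorization error exp (- D), integrated over all r-tuples
      of total measure V^r, is exactly 1.\<close>
    define D where "D = r * l"
    have D: "D \<ge> 0" using l by (simp add: D_def)
    have eD: "exp (- D) * V ^ r = 1"
      unfolding D_def l(2)[symmetric] by (simp add: exp_of_nat_mult[symmetric] exp_add[symmetric])
    \<comment> \<open>A bound for the volume that is at least 1, so that its exponent can be raised
      to r for all retractions alike.\<close>
    define w where "w = B * exp (\<epsilon> * (L * D))"
    have w: "w \<ge> 1" "vol (L * D) \<le> w"
    proof -
      have "1 * 1 \<le> B * exp (\<epsilon> * (L * D))"
        using B(1) \<epsilon> L D by (intro mult_mono) auto
      then show "w \<ge> 1" by (simp add: w_def)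
      show "vol (L * D) \<le> w" unfolding w_def using L D by (intro B(2)) auto
    qed
    have w_r: "w ^ r \<le> B ^ r * exp (l / 4)"
    proof -
      have "w ^ r = B ^ r * exp (r * (\<epsilon> * (L * r)) * l)"
        by (simp add: w_def power_mult_distrib exp_of_nat_mult[symmetric] D_def mult_ac)
      also have "\<dots> \<le> B ^ r * exp (1 / 4 * l)"
        using mult_right_mono[OF \<epsilon>_le l(1)] B(1) by (intro mult_left_mono) (simp_all only: exp_le_cancel_iff, simp)
      finally show ?thesis by simp
    qed
    \<comment> \<open>A retraction has at most (r - 1) / 2 values. Counting in powers of the square
      root W of V avoids half-integral exponents, and one factor of W is gained over W^r.\<close>
    have term_le: "V ^ card (\<rho> ` {..<r}) * vol (L * D) ^ (r - card (\<rho> ` {..<r})) \<le> W ^ (r - 1) * w ^ r"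
      if "\<rho> \<in> retractions r" for \<rho>
    proof (rule mult_mono)
      have "V ^ card (\<rho> ` {..<r}) = W ^ (2 * card (\<rho> ` {..<r}))"
        by (simp add: W(2)[symmetric] power_mult)
      also have "\<dots> \<le> W ^ (r - 1)"
        using that W(1) by (intro power_increasing) (auto simp: retractions_def)
      finally show "V ^ card (\<rho> ` {..<r}) \<le> W ^ (r - 1)" .
      have "vol (L * D) ^ (r - card (\<rho> ` {..<r})) \<le> w ^ (r - card (\<rho> ` {..<r}))"
        using w vol_nonneg by (intro power_mono) auto
      also have "\<dots> \<le> w ^ r"
        using w by (intro power_increasing) auto
      finally show "vol (L * D) ^ (r - card (\<rho> ` {..<r})) \<le> w ^ r" .
    qed (use W(1) vol_nonneg in auto)
    have Wr: "W ^ r = W ^ (r - 1) * W"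
      using r by (metis One_nat_def Suc_diff_1 less_le_trans pos2 power_Suc2)
    have "\<bar>(\<integral>x. S (F T) x ^ r \<partial>M) - real (r - 1) * ((\<integral>x. S (F T) x ^ 2 \<partial>M) * (\<integral>x. S (F T) x ^ (r - 2) \<partial>M))\<bar>
        \<le> C * (exp (- D) * V ^ r + (\<Sum>\<rho>\<in>retractions r. V ^ card (\<rho> ` {..<r}) * vol (L * D) ^ (r - card (\<rho> ` {..<r}))))"
      unfolding V_def by (rule bound[OF D F])
    also have "\<dots> \<le> C * (1 + n * (W ^ (r - 1) * w ^ r))"
      unfolding eD n_def using C term_le by (intro mult_left_mono add_left_mono sum_bounded_above) auto
    also have "\<dots> \<le> C * (W ^ (r - 1) * exp (l / 4) + n * (W ^ (r - 1) * (B ^ r * exp (l / 4))))"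
    proof (intro mult_left_mono add_mono C)
      have "1 * 1 \<le> W ^ (r - 1) * exp (l / 4)"
        using W(1) l by (intro mult_mono) auto
      then show "1 \<le> W ^ (r - 1) * exp (l / 4)" by simp
    qed (use w_r W(1) in \<open>auto simp: n_def\<close>)
    also have "\<dots> = K * W ^ (r - 1) * exp (l / 4)"
      by (simp add: K_def algebra_simps)
    finally have le: "\<bar>(\<integral>x. S (F T) x ^ r \<partial>M) - real (r - 1) * ((\<integral>x. S (F T) x ^ 2 \<partial>M) * (\<integral>x. S (F T) x ^ (r - 2) \<partial>M))\<bar>
        \<le> K * W ^ (r - 1) * exp (l / 4)" .
    have Wr2: "W ^ r = W ^ 2 * W ^ (r - 2)"
      using r by (metis le_add_diff_inverse power_add)
    have "moment r (F T) - real (r - 1) * (moment 2 (F T) * moment (r - 2) (F T))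
        = ((\<integral>x. S (F T) x ^ r \<partial>M) - real (r - 1) * ((\<integral>x. S (F T) x ^ 2 \<partial>M) * (\<integral>x. S (F T) x ^ (r - 2) \<partial>M))) / W ^ r"
      unfolding moment_eq V_def[symmetric] W_def[symmetric] Wr2 by (simp add: diff_divide_distrib)
    also have "\<bar>\<dots>\<bar> \<le> K * W ^ (r - 1) * exp (l / 4) / W ^ r"
      using le W(1) by (simp add: abs_divide divide_right_mono)
    also have "\<dots> = K * (exp (l / 4) / W)"
      unfolding Wr using W(1) by simp
    also have "exp (l / 4) / W = exp (- (1 / 4) * l)"
      unfolding W(3) exp_diff[symmetric] by simp
    finally show ?thesis by (simp add: l_def V_def)
  qed
  have "filterlim (\<lambda>T. ln (measure m (F T))) at_top sequentially"
    by (rule filterlim_compose[OF ln_at_top big])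
  then have "filterlim (\<lambda>T. - (1 / 4) * ln (measure m (F T))) at_bot sequentially"
    by (intro filterlim_tendsto_neg_mult_at_bot[OF tendsto_const]) auto
  then have "(\<lambda>T. exp (- (1 / 4) * ln (measure m (F T)))) \<longlonglongrightarrow> 0"
    by (rule filterlim_compose[OF exp_at_bot])
  then have lim: "(\<lambda>T. K * exp (- (1 / 4) * ln (measure m (F T)))) \<longlonglongrightarrow> 0"
    by (rule tendsto_mult_right_zero)
  have "\<forall>\<^sub>F T in sequentially. measure m (F T) \<ge> 1"
    using big by (simp add: filterlim_at_top)
  then have "\<forall>\<^sub>F T in sequentially. norm (moment r (F T) - real (r - 1) * (moment 2 (F T) * moment (r - 2) (F T)))
      \<le> K * exp (- (1 / 4) * ln (measure m (F T)))"
    by eventually_elim (use main in simp)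
  then show ?thesis
    using lim by (rule Lim_null_comparison)
qed

section \<open>Covariance and the limit of the second moment\<close>

definition cov :: "'h \<Rightarrow> real" where "cov h = (\<integral>x. f x * trans_fun act h f x \<partial>M)"

text \<open>Invariance of the measure lets both factors be translated by g, so the correlation of
  two translates depends only on \<open>- g + h\<close>. This is the form met in the double integral
  over F.\<close>

lemma cov_fb: "cov (- g + h) = (\<integral>x. fb (act (- g) x) * fb (act (- h) x) \<partial>M)"
proof -
  let ?u = "\<lambda>x. f x * trans_fun act (- g + h) f x"
  have "?u \<in> borel_measurable M"
    by (intro A_measurable A_mult A_trans fA)
  then have "cov (- g + h) = (\<integral>x. trans_fun act g ?u x \<partial>M)"
    unfolding cov_def by (rule integral_trans_fun[symmetric])
  also have "trans_fun act g ?u = (\<lambda>x. trans_fun act g f x * trans_fun act h f x)"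
  proof -
    have "trans_fun act g ?u = (\<lambda>x. trans_fun act g f x * trans_fun act g (trans_fun act (- g + h) f) x)"
      by (simp add: trans_fun_def)
    then show ?thesis
      by (simp add: trans_fun_trans_fun[OF action] add.assoc[symmetric])
  qed
  also have "(\<integral>x. trans_fun act g f x * trans_fun act h f x \<partial>M) = (\<integral>x. fb (act (- g) x) * fb (act (- h) x) \<partial>M)"
  proof (rule integral_cong_AE)
    show "AE x in M. trans_fun act g f x * trans_fun act h f x = fb (act (- g) x) * fb (act (- h) x)"
      using AE_trans_fb[of g] AE_trans_fb[of h] by eventually_elim simp
  qed (auto intro: A_measurable A_mult A_trans fA)
  finally show ?thesis .
qed

lemma cov_measurable[measurable]: "cov \<in> borel_measurable borel"
proof -
  have "cov = (\<lambda>h. \<integral>x. fb (act (- 0) x) * fb (act (- h) x) \<partial>M)"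
    using cov_fb[of 0] by auto
  moreover have [measurable]: "(\<lambda>p. act (- fst p) (snd p)) \<in> borel \<Otimes>\<^sub>M M \<rightarrow>\<^sub>M M"
    by (rule act_uminus_measurable) simp
  have "(\<lambda>(h, x). fb (act (- 0) x) * fb (act (- h) x)) \<in> borel_measurable (borel \<Otimes>\<^sub>M M)"
    unfolding split_beta' by measurable
  ultimately show ?thesis
    using borel_measurable_lebesgue_integral by simp
qed

text \<open>Two-point mixing at the identity and h; the product of the means is zero.\<close>

lemma cov_exp_decay: "\<exists>\<delta>>0. \<exists>C\<ge>0. \<forall>h. \<bar>cov h\<bar> \<le> C * exp (- \<delta> * dist h 0)"
proof -
  obtain \<delta> s0 where \<delta>: "\<delta> > 0" and mix: "\<forall>s>s0. \<exists>C\<ge>0. \<forall>u (g :: nat \<Rightarrow> 'h) L. (\<forall>i<2. u i \<in> A) \<and>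
      (\<forall>i<2. \<forall>j<2. i \<noteq> j \<longrightarrow> L \<le> dist (g i) (g j)) \<longrightarrow>
      \<bar>(\<integral>x. (\<Prod>i<2. trans_fun act (g i) (u i) x) \<partial>M) - (\<Prod>i<2. \<integral>x. u i x \<partial>M)\<bar>
        \<le> C * exp (- \<delta> * L) * (\<Prod>i<2. N s (u i))"
    using mixing_separated[of 2] by auto
  obtain C where C: "C \<ge> 0" "\<forall>u (g :: nat \<Rightarrow> 'h) L. (\<forall>i<2. u i \<in> A) \<and>
      (\<forall>i<2. \<forall>j<2. i \<noteq> j \<longrightarrow> L \<le> dist (g i) (g j)) \<longrightarrow>
      \<bar>(\<integral>x. (\<Prod>i<2. trans_fun act (g i) (u i) x) \<partial>M) - (\<Prod>i<2. \<integral>x. u i x \<partial>M)\<bar>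
        \<le> C * exp (- \<delta> * L) * (\<Prod>i<2. N (Suc s0) (u i))"
    using mix[rule_format, of "Suc s0"] by auto
  have tr0: "trans_fun act 0 f = f"
    using action by (simp add: trans_fun_def group_action_def)
  have "\<bar>cov h\<bar> \<le> (C * (N (Suc s0) f * N (Suc s0) f)) * exp (- \<delta> * dist h 0)" for h
  proof -
    have "\<bar>(\<integral>x. (\<Prod>i<2. trans_fun act ((\<lambda>i::nat. if i = 0 then 0 else h) i) f x) \<partial>M) - (\<Prod>i<(2::nat). \<integral>x. f x \<partial>M)\<bar>
        \<le> C * exp (- \<delta> * dist h 0) * (\<Prod>i<(2::nat). N (Suc s0) f)"
      by (rule C(2)[rule_format, of "\<lambda>_. f" "dist h 0" "\<lambda>i. if i = 0 then 0 else h"])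
        (auto simp: fA dist_commute)
    then show ?thesis
      by (simp add: numeral_2_eq_2 tr0 cov_def mean0 mult_ac)
  qed
  moreover have "0 \<le> C * (N (Suc s0) f * N (Suc s0) f)"
    using C(1) fA by (intro mult_nonneg_nonneg N_nonneg) auto
  ultimately show ?thesis using \<delta> by blast
qed

text \<open>At distance between n and n + 1 the integrand is at most exp (- \<delta> n), and the
  ball of radius n + 1 has volume at most a constant times exp (\<delta> n / 2). Growth at half the
  decay rate leaves a geometric series.\<close>

lemma exp_dist_integrable:
  assumes \<delta>: "\<delta> > 0"
  shows "integrable m (\<lambda>h. exp (- \<delta> * dist h 0))"
proof (rule integrableI_nonneg)
  obtain B where B: "B \<ge> 1" "\<And>R. R \<ge> 0 \<Longrightarrow> vol R \<le> B * exp (\<delta> / 2 * R)"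
    using vol_subexp[of "\<delta> / 2"] \<delta> by auto
  have [measurable]: "cball (0::'h) R \<in> sets borel" for R
    by (simp add: borel_closed)
  let ?t = "\<lambda>n. exp (- \<delta> * real n) * vol (real (Suc n))"
  have "(\<integral>\<^sup>+ h. ennreal (exp (- \<delta> * dist h 0)) \<partial>m)
      \<le> (\<integral>\<^sup>+ h. (\<Sum>n. ennreal (exp (- \<delta> * real n)) * indicator (cball 0 (real (Suc n))) h) \<partial>m)"
  proof (rule nn_integral_mono)
    fix h :: 'h
    define n where "n = nat \<lfloor>dist h 0\<rfloor>"
    have "real n = of_int \<lfloor>dist h 0\<rfloor>" by (simp add: n_def)
    then have n: "real n \<le> dist h 0" "dist h 0 \<le> real (Suc n)"
      using of_int_floor_le[of "dist h 0"] real_of_int_floor_add_one_ge[of "dist h 0"] by linarith+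
    have "ennreal (exp (- \<delta> * dist h 0)) \<le> ennreal (exp (- \<delta> * real n)) * indicator (cball 0 (real (Suc n))) h"
      using n \<delta> by (auto simp: indicator_def dist_commute intro!: ennreal_leI)
    also have "\<dots> \<le> (\<Sum>n. ennreal (exp (- \<delta> * real n)) * indicator (cball 0 (real (Suc n))) h)"
      using sum_le_suminf[of "\<lambda>n. ennreal (exp (- \<delta> * real n)) * indicator (cball 0 (real (Suc n))) h" "{n}"]
      by (simp only: sum.insert sum.empty finite.intros empty_iff not_False_eq_True add_0_right summableI zero_le simp_thms)
    finally show "ennreal (exp (- \<delta> * dist h 0)) \<le> (\<Sum>n. ennreal (exp (- \<delta> * real n)) * indicator (cball 0 (real (Suc n))) h)" .
  qed
  also have "\<dots> = (\<Sum>n. \<integral>\<^sup>+ h. ennreal (exp (- \<delta> * real n)) * indicator (cball 0 (real (Suc n))) h \<partial>m)"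
    by (intro nn_integral_suminf) measurable
  also have "\<dots> = (\<Sum>n. ennreal (?t n))"
    by (intro suminf_cong) (simp add: nn_integral_cmult_indicator borel_closed emeasure_cball ennreal_mult vol_nonneg del: of_nat_Suc)
  also have "\<dots> < \<infinity>"
  proof -
    have "summable (\<lambda>n. (B * exp (\<delta> / 2)) * exp (- \<delta> / 2) ^ n)"
      using \<delta> by (intro summable_mult summable_geometric) simp
    moreover have "norm (?t n) \<le> (B * exp (\<delta> / 2)) * exp (- \<delta> / 2) ^ n" for n
    proof -
      have "?t n \<le> exp (- \<delta> * real n) * (B * exp (\<delta> / 2 * real (Suc n)))"
        by (intro mult_left_mono B(2)) auto
      also have "\<dots> = (B * exp (\<delta> / 2)) * exp (- \<delta> / 2) ^ n"
      proof -
        have "- \<delta> * real n + \<delta> / 2 * real (Suc n) = \<delta> / 2 + real n * (- \<delta> / 2)"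
          by (simp add: field_simps)
        then have "exp (- \<delta> * real n) * exp (\<delta> / 2 * real (Suc n)) = exp (\<delta> / 2) * exp (- \<delta> / 2) ^ n"
          unfolding exp_of_nat_mult[symmetric] exp_add[symmetric] by (rule arg_cong)
        then show ?thesis by (metis mult.assoc mult.left_commute)
      qed
      finally show ?thesis by (simp add: vol_nonneg)
    qed
    ultimately have "summable ?t"
      by (rule summable_comparison_test'[where N = 0])
    then have "(\<Sum>n. ennreal (?t n)) = ennreal (\<Sum>n. ?t n)"
      by (intro suminf_ennreal2) (auto simp: vol_nonneg)
    then show ?thesis by simp
  qed
  finally show "(\<integral>\<^sup>+ h. ennreal (exp (- \<delta> * dist h 0)) \<partial>m) < \<infinity>" .
qed auto

lemma cov_integrable: "integrable m cov"
proof -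
  obtain \<delta> C where \<delta>: "\<delta> > 0" and C: "\<And>h. \<bar>cov h\<bar> \<le> C * exp (- \<delta> * dist h 0)"
    using cov_exp_decay by auto
  show ?thesis
    by (rule Bochner_Integration.integrable_bound[OF integrable_mult_right[OF exp_dist_integrable[OF \<delta>], of C]])
      (use C order_trans[OF C abs_ge_self] in auto)
qed

lemma integral_translate:
  fixes u :: "'h \<Rightarrow> real"
  assumes [measurable]: "u \<in> borel_measurable borel"
  shows "(\<integral>h. u (g + h) \<partial>m) = (\<integral>h. u h \<partial>m)"
proof -
  have [measurable]: "(\<lambda>x. g + x) \<in> m \<rightarrow>\<^sub>M m"
    by measurable
  have "distr m m (\<lambda>x. g + x) = m"
  proof (rule measure_eqI)
    fix B assume "B \<in> sets (distr m m (\<lambda>x. g + x))"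
    then have B: "B \<in> sets borel" by simp
    have "(\<lambda>x. g + x) -` B = (\<lambda>x. - g + x) ` B"
      by (force simp: add.assoc[symmetric])
    then show "emeasure (distr m m (\<lambda>x. g + x)) B = emeasure m B"
      using emeasure_translate[OF B, of "- g"] B by (simp add: emeasure_distr)
  qed simp
  then have "(\<integral>h. u h \<partial>m) = (\<integral>h. u h \<partial>distr m m (\<lambda>x. g + x))" by simp
  also have "\<dots> = (\<integral>h. u (g + h) \<partial>m)"
    by (rule integral_distr) auto
  finally show ?thesis by simp
qed

text \<open>The measure of those g in F for which g + h is again in F, that is, the weight with
  which the difference h occurs in F x F. As an integral it fits Fubini; as the measure of the
  intersection of F with a right translate it fits the Folner property.\<close>

definition overlap :: "'h set \<Rightarrow> 'h \<Rightarrow> real" where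
  "overlap F h = (\<integral>g. indicat_real F (g + h) \<partial>restr F)"

lemma overlap_eq:
  assumes "compact F"
  shows "overlap F h = measure m (F \<inter> (\<lambda>x. x + - h) ` F)"
proof -
  have [measurable]: "F \<in> sets borel" by (rule compact_borel[OF assms])
  have "(\<lambda>g. g + h) \<in> borel_measurable borel" by measurable
  then have meas: "(\<lambda>g. g + h) -` F \<in> sets borel"
    by (rule measurable_sets_borel) measurable
  have eq: "(\<lambda>g. g + h) -` F = (\<lambda>x. x + - h) ` F"
    by (force simp: add.assoc simp del: add_uminus_conv_diff)
  have "overlap F h = (\<integral>g. indicat_real ((\<lambda>g. g + h) -` F) g \<partial>restr F)"
    unfolding overlap_def by (intro Bochner_Integration.integral_cong) (auto simp: indicator_def)
  also have "\<dots> = measure (restr F) ((\<lambda>g. g + h) -` F)"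
    by simp
  also have "\<dots> = measure m (F \<inter> (\<lambda>g. g + h) -` F)"
    using meas by (simp add: measure_def emeasure_restr[OF assms])
  finally show ?thesis unfolding eq .
qed

lemma overlap_measurable:
  assumes "compact F"
  shows "overlap F \<in> borel_measurable borel"
proof -
  interpret finite_measure "restr F" by (rule finite_measure_restr[OF assms])
  have [measurable]: "F \<in> sets borel" by (rule compact_borel[OF assms])
  have "(\<lambda>(h, g). indicat_real F (g + h)) \<in> borel_measurable (borel \<Otimes>\<^sub>M restr F)"
    unfolding split_beta' by measurable
  then show ?thesis
    unfolding overlap_def by (rule borel_measurable_lebesgue_integral)
qed

text \<open>The double integral over F of \<open>cov (- g + h)\<close> is sorted by the difference
  of the two points: the substitution of g + h for h is allowed by left invariance, and then g is
  integrated out.\<close>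

lemma second_moment:
  assumes "compact F"
  shows "(\<integral>x. S F x ^ 2 \<partial>M) = (\<integral>h. cov h * overlap F h \<partial>m)"
proof -
  let ?\<nu> = "restr F"
  interpret \<nu>: finite_measure ?\<nu> by (rule finite_measure_restr[OF assms])
  interpret pair: pair_sigma_finite ?\<nu> M by standard
  interpret pairf: finite_measure "?\<nu> \<Otimes>\<^sub>M M"
    by (intro finite_measure_pair_measure finite_measure_axioms \<nu>.finite_measure_axioms)
  interpret pm: pair_sigma_finite ?\<nu> m by standard
  have [measurable]: "F \<in> sets borel" by (rule compact_borel[OF assms])
  have [measurable]: "(\<lambda>p. act (- fst p) (snd p)) \<in> ?\<nu> \<Otimes>\<^sub>M M \<rightarrow>\<^sub>M M"
    by (rule act_uminus_measurable) simp
  have [measurable]: "S F \<in> borel_measurable M" by (rule S_measurable[OF assms])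
  have swap: "(\<integral>x. fb (act (- g) x) * S F x \<partial>M) = (\<integral>h. cov (- g + h) \<partial>?\<nu>)" for g
  proof -
    have int: "integrable (?\<nu> \<Otimes>\<^sub>M M) (\<lambda>(h, x). fb (act (- g) x) * fb (act (- h) x))"
    proof (rule pairf.integrable_const_bound[of _ "bd * bd"])
      show "AE p in ?\<nu> \<Otimes>\<^sub>M M. norm (case p of (h, x) \<Rightarrow> fb (act (- g) x) * fb (act (- h) x)) \<le> bd * bd"
        using fb_bounded bd(1) by (intro AE_I2) (auto simp: abs_mult intro!: mult_mono)
    qed (unfold split_beta', measurable)
    have "(\<integral>x. fb (act (- g) x) * S F x \<partial>M) = (\<integral>x. (\<integral>h. fb (act (- g) x) * fb (act (- h) x) \<partial>?\<nu>) \<partial>M)"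
      by (simp add: S_def)
    also have "\<dots> = (\<integral>h. (\<integral>x. fb (act (- g) x) * fb (act (- h) x) \<partial>M) \<partial>?\<nu>)"
      by (rule pair.Fubini_integral[OF int])
    finally show ?thesis by (simp add: cov_fb)
  qed
  have int1: "integrable (?\<nu> \<Otimes>\<^sub>M M) (\<lambda>(g, x). fb (act (- g) x) * S F x)"
  proof (rule pairf.integrable_const_bound[of _ "bd * (bd * measure m F)"])
    show "AE p in ?\<nu> \<Otimes>\<^sub>M M. norm (case p of (g, x) \<Rightarrow> fb (act (- g) x) * S F x) \<le> bd * (bd * measure m F)"
      using fb_bounded bd(1) S_bounded[OF assms] by (intro AE_I2) (auto simp: abs_mult intro!: mult_mono)
  qed (unfold split_beta', measurable)
  \<comment> \<open>The finite measure of F and the integrability of the covariance dominate this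
    function on the product, which justifies exchanging the integrals after the
    substitution.\<close>
  have int2: "integrable (?\<nu> \<Otimes>\<^sub>M m) (\<lambda>(g, h). cov h * indicat_real F (g + h))"
  proof (rule Bochner_Integration.integrable_bound)
    show "integrable (?\<nu> \<Otimes>\<^sub>M m) (\<lambda>(g, h). cov h)"
      using cov_integrable by (intro pm.Fubini_integrable) (auto simp: split_beta')
    show "(\<lambda>(g, h). cov h * indicat_real F (g + h)) \<in> borel_measurable (?\<nu> \<Otimes>\<^sub>M m)"
      unfolding split_beta' by measurable
  qed (auto simp: indicator_def)
  have "(\<integral>x. S F x ^ 2 \<partial>M) = (\<integral>x. (\<integral>g. fb (act (- g) x) * S F x \<partial>?\<nu>) \<partial>M)"
    by (simp add: S_def power2_eq_square)
  also have "\<dots> = (\<integral>g. (\<integral>x. fb (act (- g) x) * S F x \<partial>M) \<partial>?\<nu>)"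
    by (rule pair.Fubini_integral[OF int1])
  also have "\<dots> = (\<integral>g. (\<integral>h. cov (- g + h) \<partial>?\<nu>) \<partial>?\<nu>)"
    by (simp only: swap)
  also have "\<dots> = (\<integral>g. (\<integral>h. cov h * indicat_real F (g + h) \<partial>m) \<partial>?\<nu>)"
  proof (rule Bochner_Integration.integral_cong[OF refl])
    fix g
    have "(\<integral>h. cov (- g + h) \<partial>?\<nu>) = (\<integral>h. indicat_real F h * cov (- g + h) \<partial>m)"
      by (subst integral_restr[OF assms]) (simp_all add: set_lebesgue_integral_def)
    also have "\<dots> = (\<integral>h. indicat_real F (g + h) * cov (- g + (g + h)) \<partial>m)"
      by (rule integral_translate[symmetric]) measurable
    finally show "(\<integral>h. cov (- g + h) \<partial>?\<nu>) = (\<integral>h. cov h * indicat_real F (g + h) \<partial>m)"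
      by (simp add: add.assoc[symmetric] mult.commute)
  qed
  also have "\<dots> = (\<integral>h. (\<integral>g. cov h * indicat_real F (g + h) \<partial>?\<nu>) \<partial>m)"
    by (rule pm.Fubini_integral[OF int2, symmetric])
  also have "\<dots> = (\<integral>h. cov h * overlap F h \<partial>m)"
    by (simp add: overlap_def)
  finally show ?thesis .
qed

lemma compact_translate: "compact F \<Longrightarrow> compact ((\<lambda>x. x + h) ` F)" for F :: "'h set"
proof (rule compact_continuous_image)
  have "continuous_on UNIV (\<lambda>x::'h. (x, h))"
    by (intro continuous_intros)
  then have "continuous_on UNIV ((\<lambda>p::'h \<times> 'h. fst p + snd p) \<circ> (\<lambda>x. (x, h)))"
    by (rule continuous_on_compose) (rule continuous_on_subset[OF topgrp_add], simp)
  then show "continuous_on F (\<lambda>x. x + h)"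
    by (simp add: o_def) (rule continuous_on_subset, auto)
qed

lemma compact_fmeasurable: "compact K \<Longrightarrow> K \<in> fmeasurable m"
  using emeasure_compact[of K] compact_borel[of K] by (intro fmeasurableI) auto

text \<open>The normalized overlap lies between 0 and 1 and tends to 1 for each h, so dominated
  convergence applies with the absolute covariance as majorant.\<close>

lemma second_moment_limit:
  assumes folner: "right_folner m F"
    and big: "filterlim (\<lambda>T. measure m (F T)) at_top sequentially"
  shows "(\<lambda>T. moment 2 (F T)) \<longlonglongrightarrow> (\<integral>h. cov h \<partial>m)"
proof -
  have F: "compact (F T)" for T
    using folner by (simp add: right_folner_def)
  have "moment 2 (F T) = (\<integral>h. cov h * (overlap (F T) h / measure m (F T)) \<partial>m)" for T
    unfolding moment_eq second_moment[OF F] by simp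
  moreover have "(\<lambda>T. \<integral>h. cov h * (overlap (F T) h / measure m (F T)) \<partial>m) \<longlonglongrightarrow> (\<integral>h. cov h \<partial>m)"
  proof (rule integral_dominated_convergence[where w = "\<lambda>h. \<bar>cov h\<bar>"])
    show "integrable m (\<lambda>h. \<bar>cov h\<bar>)" using cov_integrable by simp
    show "(\<lambda>h. cov h * (overlap (F T) h / measure m (F T))) \<in> borel_measurable m" for T
      using overlap_measurable[OF F, of T] by simp
    have le: "overlap (F T) h \<le> measure m (F T)" for T h
    proof -
      have "F T \<inter> (\<lambda>x. x + - h) ` F T \<in> sets m"
        unfolding sets_m by (intro sets.Int compact_borel compact_translate F)
      then show ?thesis
        unfolding overlap_eq[OF F] using F by (intro measure_mono_fmeasurable compact_fmeasurable) auto
    qed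
    show "AE h in m. norm (cov h * (overlap (F T) h / measure m (F T))) \<le> \<bar>cov h\<bar>" for T
    proof (rule AE_I2)
      fix h
      \<comment> \<open>This holds for every T, since a quotient by zero has the value 0.\<close>
      have "\<bar>overlap (F T) h / measure m (F T)\<bar> \<le> 1"
        using le[of T h] by (simp add: overlap_eq[OF F] divide_le_eq_1 less_le)
      then show "norm (cov h * (overlap (F T) h / measure m (F T))) \<le> \<bar>cov h\<bar>"
        using mult_left_le[of _ "\<bar>cov h\<bar>"] by (simp only: real_norm_def abs_mult abs_ge_zero)
    qed
    have "(\<lambda>T. overlap (F T) h / measure m (F T)) \<longlonglongrightarrow> 1" for h
    proof -
      \<comment> \<open>The overlap at h involves the right translate by \<open>- h\<close>, so the
        Folner condition is used at \<open>- h\<close>. What F loses in the intersection is part of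
        the symmetric difference.\<close>
      let ?F' = "\<lambda>T. (\<lambda>x. x + - h) ` F T"
      let ?\<Delta> = "\<lambda>T. measure m ((F T - ?F' T) \<union> (?F' T - F T)) / measure m (F T)"
      have fm: "F T \<in> fmeasurable m" "?F' T \<in> fmeasurable m" for T
        using F by (intro compact_fmeasurable compact_translate; simp)+
      have lower: "1 - ?\<Delta> T \<le> overlap (F T) h / measure m (F T)" if V: "measure m (F T) > 0" for T
      proof -
        have "F T \<inter> ?F' T \<in> fmeasurable m" "F T - ?F' T \<in> fmeasurable m"
          by (intro fmeasurable.Int fmeasurable.Diff fm)+
        note parts = this[THEN fmeasurableD2] this[THEN fmeasurableD]
        have "measure m (F T) = measure m ((F T \<inter> ?F' T) \<union> (F T - ?F' T))"
          by (intro arg_cong[of _ _ "measure m"]) auto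
        also have "\<dots> = measure m (F T \<inter> ?F' T) + measure m (F T - ?F' T)"
          using parts by (intro measure_Union) auto
        also have "measure m (F T - ?F' T) \<le> measure m ((F T - ?F' T) \<union> (?F' T - F T))"
          by (intro measure_mono_fmeasurable parts(4) fmeasurable.Un fmeasurable.Diff fm) auto
        finally have "measure m (F T) / measure m (F T)
            \<le> (overlap (F T) h + measure m ((F T - ?F' T) \<union> (?F' T - F T))) / measure m (F T)"
          unfolding overlap_eq[OF F] by (intro divide_right_mono) simp_all
        then show ?thesis
          using V by (simp add: add_divide_distrib)
      qed
      have "?\<Delta> \<longlonglongrightarrow> 0"
        using folner unfolding right_folner_def by blast
      then have "(\<lambda>T. 1 - ?\<Delta> T) \<longlonglongrightarrow> 1 - 0"
        by (intro tendsto_intros)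
      then have lim: "(\<lambda>T. 1 - ?\<Delta> T) \<longlonglongrightarrow> 1" by simp
      have "\<forall>\<^sub>F T in sequentially. measure m (F T) > 0"
        using big by (simp add: filterlim_at_top_dense)
      then have ev: "\<forall>\<^sub>F T in sequentially. 1 - ?\<Delta> T \<le> overlap (F T) h / measure m (F T)"
        "\<forall>\<^sub>F T in sequentially. overlap (F T) h / measure m (F T) \<le> 1"
        by (eventually_elim, use lower le in simp)+
      show ?thesis
        by (rule tendsto_sandwich[OF ev lim tendsto_const])
    qed
    then have "(\<lambda>T. cov h * (overlap (F T) h / measure m (F T))) \<longlonglongrightarrow> cov h * 1" for h
      by (intro tendsto_intros)
    then show "AE h in m. (\<lambda>T. cov h * (overlap (F T) h / measure m (F T))) \<longlonglongrightarrow> cov h"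
      by simp
  qed simp
  ultimately show ?thesis by simp
qed

text \<open>The recursion lowers the order by two, so the induction starts from the total mass at
  order 0 and the vanishing mean at order 1.\<close>

lemma moment_limit:
  assumes folner: "right_folner m F"
    and big: "filterlim (\<lambda>T. measure m (F T)) at_top sequentially"
  shows "(\<lambda>T. moment k (F T)) \<longlonglongrightarrow> normal_moment (\<integral>h. cov h \<partial>m) k"
proof -
  have F: "compact (F T)" for T
    using folner by (simp add: right_folner_def)
  define v where "v = (\<integral>h. cov h \<partial>m)"
  have "(\<lambda>T. moment k (F T)) \<longlonglongrightarrow> normal_moment v k"
  proof (induction k rule: induct_nat_012)
    case 0
    show ?case by (simp add: moment_def prob_space)
  next
    case 1
    have "corr {..<1} h = 0" for h
      using corr_singleton[of 0 h] by (simp add: lessThan_Suc)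
    then have "moment (Suc 0) (F T) = 0" for T
      using integral_corr(1)[OF F, where r = 1] by (simp add: moment_eq)
    then show ?case by simp
  next
    case (ge2 k)
    have "(\<lambda>T. (moment (Suc (Suc k)) (F T) - real (Suc k) * (moment 2 (F T) * moment k (F T)))
        + real (Suc k) * (moment 2 (F T) * moment k (F T))) \<longlonglongrightarrow> 0 + real (Suc k) * (v * normal_moment v k)"
      using moment_recursion_limit[of "Suc (Suc k)" F, OF _ F big] ge2 second_moment_limit[OF folner big]
      by (intro tendsto_intros) (auto simp: v_def)
    then show ?case by (simp add: mult.assoc)
  qed
  then show ?thesis by (simp add: v_def)
qed

lemma normal_limit:
  assumes folner: "right_folner m F"
    and big: "filterlim (\<lambda>T. measure m (F T)) at_top sequentially"
  shows "weak_conv_m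
     (\<lambda>T. distr M borel (\<lambda>x. (LINT h:F T|m. trans_fun act h f x) / sqrt (measure m (F T))))
     (normal_law (\<integral>h. cov h \<partial>m))"
proof -
  have F: "compact (F T)" for T
    using folner by (simp add: right_folner_def)
  define X where "X T x = S (F T) x / sqrt (measure m (F T))" for T x
  have X_meas: "X T \<in> borel_measurable M" for T
    unfolding X_def using S_measurable[OF F, of T] by simp
  \<comment> \<open>The variance is nonnegative as a limit of integrals of squares. It may be zero,
    in which case the limit law is the point mass at 0.\<close>
  have "0 \<le> moment 2 (F T)" for T
    by (simp add: moment_def)
  then have "0 \<le> (\<integral>h. cov h \<partial>m)"
    by (intro LIMSEQ_le_const[OF second_moment_limit[OF folner big]]) auto
  then have "weak_conv_m (\<lambda>T. distr M borel (X T)) (normal_law (\<integral>h. cov h \<partial>m))"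
    using moment_limit[OF folner big] S_power_integrable[OF F]
    by (intro moments_imp_weak_conv_normal X_meas) (simp_all add: X_def moment_def power_divide)
  moreover have "distr M borel (X T)
      = distr M borel (\<lambda>x. (LINT h:F T|m. trans_fun act h f x) / sqrt (measure m (F T)))" for T
  proof (rule distr_cong_AE)
    show "AE x in M. X T x = (LINT h:F T|m. trans_fun act h f x) / sqrt (measure m (F T))"
      using AE_orbit_integral[OF F, of T] by eventually_elim (simp add: X_def)
    show "(\<lambda>x. (LINT h:F T|m. trans_fun act h f x) / sqrt (measure m (F T))) \<in> borel_measurable M"
      using orbit_integral_measurable[OF F, of T] by simp
  qed (use X_meas in auto)
  ultimately show ?thesis by simp
qed

end

theorem theorem1p1:
  fixes m :: "'h::{metric_space, second_countable_topology, group_add} measure"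
    and M :: "'x measure" and act :: "'h \<Rightarrow> 'x \<Rightarrow> 'x"
    and A :: "('x \<Rightarrow> real) set" and N :: "nat \<Rightarrow> ('x \<Rightarrow> real) \<Rightarrow> real"
    and F :: "nat \<Rightarrow> 'h set" and f :: "'x \<Rightarrow> real"
  assumes topgrp_add: "continuous_on UNIV (\<lambda>p::'h \<times> 'h. fst p + snd p)"
    and topgrp_inv: "continuous_on UNIV (uminus :: 'h \<Rightarrow> 'h)"
    and left_inv_metric: "\<forall>g x y::'h. dist (g + x) (g + y) = dist x y"
    and proper_metric: "\<forall>r. compact (cball (0::'h) r)"
    and haar: "left_haar m"
    and subexp: "Limsup at_top (\<lambda>r. ereal (ln (measure m (ball 0 r)) / r)) = 0"
    and folner: "right_folner m F"
    and folner_big: "filterlim (\<lambda>T. measure m (F T)) at_top sequentially"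
    and prob: "prob_space M"
    and action: "group_action act"
    and joint_meas: "(\<lambda>(h, x). act h x) \<in> measurable (m \<Otimes>\<^sub>M M) M"
    and mpres: "\<forall>h. act h \<in> M \<rightarrow>\<^sub>M M \<and> distr M M (act h) = M"
    and alg: "inv_subalgebra M act A"
    and seminorms: "adm_seminorms M act A N"
    and mixing: "exp_mixing_all_orders M act A N"
    and fA: "f \<in> A"
    and mean0: "(\<integral>x. f x \<partial>M) = 0"
  shows "weak_conv_m
     (\<lambda>T. distr M borel (\<lambda>x. (LINT h:F T|m. trans_fun act h f x) / sqrt (measure m (F T))))
     (normal_law (LINT h|m. (\<integral>x. f x * trans_fun act h f x \<partial>M)))"
proof -
  interpret prob_space M by (rule prob)
  interpret haar_mixing_system M act A N f m
    using assms by unfold_locales auto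
  show ?thesis
    using normal_limit[OF folner folner_big] by (simp add: cov_def)
qed

end
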